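(* Let $(X,d)$ be a compact metric space, let $\mathbb{I}=\{S_1,\dots,S_N\}$ be an iterated function system of similarities on $X$ with similarity dimension $s$, and let $C\subseteq X$ be a non-empty compact set with $\max\{s,\underline{\dim}_{\mathrm B}C\}<\overline{\dim}_{\mathrm B}C$. Let $F_\emptyset$ be the homogeneous attractor of $\mathbb{I}$ and $F_C$ the inhomogeneous attractor of $\mathbb{I}$ with condensation $C$. Suppose that $(X,d)$ is Ahlfors regular and that $\mathbb{I}$ together with $C$ satisfies the condensation open set condition (COSC). Then for all $t\ge0$, $$\underline{\dim}_{\mathrm B}F_C\ \ge\ p_t(C)\,t+(1-p_t(C))\,s.$$ In particular, if for some $t>\max\{s,\underline{\dim}_{\mathrm B}C\}$ we have $$p_t(C)>\max\Big\{0,\ \frac{\underline{\dim}_{\mathrm B}C-s}{t-s}\Big\},$$ then $$\underline{\dim}_{\mathrm B}F_C>\max\{\underline{\dim}_{\mathrm B}F_\emptyset,\ \underline{\dim}_{\mathrm B}C\}.$$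
   Context: An iterated function system (IFS) of similarities on $X$ is a finite collection of maps $S_i:X\to X$ such that for each $i$ there is a constant $\mathrm{Lip}(S_i)\in(0,1)$ with $d(S_i(x),S_i(y))=\mathrm{Lip}(S_i)\,d(x,y)$ for all $x,y\in X$. The homogeneous attractor $F_\emptyset$ is the unique non-empty compact set with $F_\emptyset=\bigcup_{i=1}^N S_i(F_\emptyset)$. The inhomogeneous attractor $F_C$ is the unique non-empty compact set with $F_C=\bigcup_{i=1}^N S_i(F_C)\cup C$. The similarity dimension $s$ is the unique solution of $\sum_{i=1}^N \mathrm{Lip}(S_i)^s=1$. COSC: there is a non-empty open set $U\subseteq X$ with $F_\emptyset\cap U\neq\emptyset$, with $\bigcup_{i=1}^N S_i(U)\subseteq U$ where the union is disjoint, and with $C\subseteq\overline{U}$. $(X,d)$ is Ahlfors regular if $\dim_{\mathrm H}X<\infty$ and there is $\lambda>0$ such that $\tfrac1\lambda r^{\dim_{\mathrm H}X}\le\mathcal{H}^{\dim_{\mathrm H}X}(B(x,r))\le\lambda r^{\dim_{\mathrm H}X}$ for all $x\in X$ and $0<r\le\mathrm{diam}(X)$, where $B(x,r)$ is the open ball, $\dim_{\mathrm H}$ is Hausdorff dimension and $\mathcal{H}^{\dim_{\mathrm H}X}$ is Hausdorff measure in dimension $\dim_{\mathrm H}X$. For a non-empty set $E\subseteq X$ and $\delta>0$, $N_\delta(E)$ is the minimum number of sets of diameter at most $\delta$ required to cover $E$; $\underline{\dim}_{\mathrm B}E$ and $\overline{\dim}_{\mathrm B}E$ are the $\liminf$ and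 $\limsup$, respectively, of $\frac{\log N_\delta(E)}{-\log\delta}$ as $\delta\to0$. Covering regularity exponents: for $t\ge0$ and $\delta\in(0,1]$, $p_{t,\delta}(C)=\sup\{p\in[0,1]:N_{\delta^p}(C)\ge\delta^{-pt}\}$, and $p_t(C)=\liminf_{\delta\to0}p_{t,\delta}(C)$. *)

theory Defs
  imports "HOL-Analysis.Analysis"
begin

text \<open>The summand \<open>diam(A)\<^sup>s\<close>, with the usual conventions that the empty set contributes 0 and
  every non-empty set contributes 1 when \<open>s = 0\<close> (whereas \<open>0 powr 0 = 0\<close> in the library).\<close>

definition diam_power :: "real \<Rightarrow> 'a::metric_space set \<Rightarrow> ennreal" where
  "diam_power s A =
     (if A = {} then 0 else if s = 0 then 1 else ennreal (diameter A powr s))"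

text \<open>The boundedness condition on the covering sets is needed because \<^const>\<open>diameter\<close> is a
  real number and carries no information about unbounded sets.\<close>

definition hausdorff_premeasure :: "real \<Rightarrow> real \<Rightarrow> 'a::metric_space set \<Rightarrow> ennreal" where
  "hausdorff_premeasure s \<delta> E =
     (INF A \<in> {A :: nat \<Rightarrow> 'a set. E \<subseteq> (\<Union>n. A n) \<and> (\<forall>n. bounded (A n) \<and> diameter (A n) \<le> \<delta>)}.
        \<Sum>n. diam_power s (A n))"

definition hausdorff_measure :: "real \<Rightarrow> 'a::metric_space set \<Rightarrow> ennreal" where
  "hausdorff_measure s E = (SUP \<delta> \<in> {0<..}. hausdorff_premeasure s \<delta> E)"

definition hausdorff_dim :: "'a::metric_space set \<Rightarrow> ereal" where
  "hausdorff_dim E = Inf (ereal ` {s. 0 \<le> s \<and> hausdorff_measure s E = 0})"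

text \<open>Meaningful for bounded \<open>X\<close>, where \<^term>\<open>diameter X\<close> is the diameter.\<close>

definition ahlfors_regular :: "'a::metric_space set \<Rightarrow> bool" where
  "ahlfors_regular X \<longleftrightarrow>
     hausdorff_dim X < \<infinity> \<and>
     (\<exists>c>0. \<forall>x\<in>X. \<forall>r. 0 < r \<and> r \<le> diameter X \<longrightarrow>
        (let d = real_of_ereal (hausdorff_dim X); m = hausdorff_measure d (ball x r \<inter> X)
         in ennreal (1 / c * r powr d) \<le> m \<and> m \<le> ennreal (c * r powr d)))"

text \<open>The minimum is over a non-empty set of cardinalities as soon as \<open>E\<close> is totally bounded,
  in particular for every subset of a compact space.\<close>

definition covering_number :: "real \<Rightarrow> 'a::metric_space set \<Rightarrow> nat" where
  "covering_number \<delta> E =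
     (LEAST n. \<exists>\<U>. finite \<U> \<and> card \<U> = n \<and> E \<subseteq> \<Union>\<U> \<and> (\<forall>A\<in>\<U>. bounded A \<and> diameter A \<le> \<delta>))"

definition lower_box_dim :: "'a::metric_space set \<Rightarrow> ereal" where
  "lower_box_dim E =
     Liminf (at_right 0) (\<lambda>\<delta>. ereal (ln (real (covering_number \<delta> E)) / - ln \<delta>))"

definition upper_box_dim :: "'a::metric_space set \<Rightarrow> ereal" where
  "upper_box_dim E =
     Limsup (at_right 0) (\<lambda>\<delta>. ereal (ln (real (covering_number \<delta> E)) / - ln \<delta>))"

definition covering_exponent_at :: "real \<Rightarrow> real \<Rightarrow> 'a::metric_space set \<Rightarrow> real" where
  "covering_exponent_at t \<delta> C =
     Sup {p \<in> {0..1}. real (covering_number (\<delta> powr p) C) \<ge> \<delta> powr (- p * t)}"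

definition covering_exponent :: "real \<Rightarrow> 'a::metric_space set \<Rightarrow> ereal" where
  "covering_exponent t C = Liminf (at_right 0) (\<lambda>\<delta>. ereal (covering_exponent_at t \<delta> C))"

definition contracting_similarity :: "('a::metric_space \<Rightarrow> 'a) \<Rightarrow> bool" where
  "contracting_similarity f \<longleftrightarrow> (\<exists>r. 0 < r \<and> r < 1 \<and> (\<forall>x y. dist (f x) (f y) = r * dist x y))"

definition Lip :: "('a::metric_space \<Rightarrow> 'a) \<Rightarrow> real" where
  "Lip f = (THE r. 0 < r \<and> r < 1 \<and> (\<forall>x y. dist (f x) (f y) = r * dist x y))"

definition similarity_ifs :: "nat \<Rightarrow> (nat \<Rightarrow> 'a::metric_space \<Rightarrow> 'a) \<Rightarrow> bool" where
  "similarity_ifs N S \<longleftrightarrow> 1 \<le> N \<and> (\<forall>i\<in>{1..N}. contracting_similarity (S i))"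

definition similarity_dim :: "nat \<Rightarrow> (nat \<Rightarrow> 'a::metric_space \<Rightarrow> 'a) \<Rightarrow> real" where
  "similarity_dim N S = (THE s. (\<Sum>i=1..N. Lip (S i) powr s) = 1)"

definition inhomogeneous_attractor ::
    "nat \<Rightarrow> (nat \<Rightarrow> 'a::metric_space \<Rightarrow> 'a) \<Rightarrow> 'a set \<Rightarrow> 'a set" where
  "inhomogeneous_attractor N S C =
     (THE F. F \<noteq> {} \<and> compact F \<and> F = (\<Union>i\<in>{1..N}. S i ` F) \<union> C)"

definition homogeneous_attractor ::
    "nat \<Rightarrow> (nat \<Rightarrow> 'a::metric_space \<Rightarrow> 'a) \<Rightarrow> 'a set" where
  "homogeneous_attractor N S = (THE F. F \<noteq> {} \<and> compact F \<and> F = (\<Union>i\<in>{1..N}. S i ` F))"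

definition condensation_open_set_condition ::
    "nat \<Rightarrow> (nat \<Rightarrow> 'a::metric_space \<Rightarrow> 'a) \<Rightarrow> 'a set \<Rightarrow> bool" where
  "condensation_open_set_condition N S C \<longleftrightarrow>
     (\<exists>U. U \<noteq> {} \<and> open U \<and> homogeneous_attractor N S \<inter> U \<noteq> {} \<and>
          (\<Union>i\<in>{1..N}. S i ` U) \<subseteq> U \<and> disjoint_family_on (\<lambda>i. S i ` U) {1..N} \<and>
          C \<subseteq> closure U)"

text \<open>In a one-point space the ratio is not determined; there all box dimensions vanish.\<close>

lemma Lip_eqI:
  fixes f :: "'a::metric_space \<Rightarrow> 'a"
  assumes "0 < r" "r < 1" "\<And>x y. dist (f x) (f y) = r * dist x y" and "(a::'a) \<noteq> b"
  shows "Lip f = r"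
  unfolding Lip_def
proof (rule the_equality)
  fix r' assume "0 < r' \<and> r' < 1 \<and> (\<forall>x y. dist (f x) (f y) = r' * dist x y)"
  then have "r' * dist a b = r * dist a b" using assms(3)[of a b] by metis
  then show "r' = r" using assms(4) by simp
qed (use assms in auto)

lemma Lip_similarity:
  fixes f :: "'a::metric_space \<Rightarrow> 'a"
  assumes "contracting_similarity f" and ab: "(a::'a) \<noteq> b"
  shows "0 < Lip f" "Lip f < 1" "dist (f x) (f y) = Lip f * dist x y"
proof -
  obtain r where r: "0 < r" "r < 1" "\<And>x y. dist (f x) (f y) = r * dist x y"
    using assms(1) unfolding contracting_similarity_def by metis
  have "Lip f = r" using Lip_eqI[OF r ab] .
  then show "0 < Lip f" "Lip f < 1" "dist (f x) (f y) = Lip f * dist x y" using r by auto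
qed

lemma similarity_dim_ex1:
  fixes S :: "nat \<Rightarrow> 'a::metric_space \<Rightarrow> 'a"
  assumes "similarity_ifs N S" and ab: "(a::'a) \<noteq> b"
  shows "\<exists>!s. (\<Sum>i=1..N. Lip (S i) powr s) = 1"
proof -
  define g where "g s = (\<Sum>i=1..N. Lip (S i) powr s)" for s
  have N: "1 \<le> N" and L: "\<And>i. i \<in> {1..N} \<Longrightarrow> 0 < Lip (S i) \<and> Lip (S i) < 1"
    using assms Lip_similarity unfolding similarity_ifs_def by blast+
  have mono: "g t < g s" if "s < t" for s t
    unfolding g_def
  proof (rule sum_strict_mono)
    show "Lip (S i) powr t < Lip (S i) powr s" if "i \<in> {1..N}" for i
      using L[OF that] \<open>s < t\<close> by (intro powr_less_mono') auto
  qed (use N in auto)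
  have lim: "(g \<longlongrightarrow> (\<Sum>i=1..N. 0)) at_top"
    unfolding g_def
  proof (rule tendsto_sum)
    fix i assume "i \<in> {1..N}"
    then have l: "0 < Lip (S i)" "Lip (S i) < 1" using L by auto
    have "((\<lambda>s. exp (ln (Lip (S i)) * s)) \<longlongrightarrow> 0) at_top"
      using l
      by (intro filterlim_compose[OF exp_at_bot] filterlim_tendsto_neg_mult_at_bot[OF tendsto_const]
          filterlim_ident) simp
    then show "((\<lambda>s. Lip (S i) powr s) \<longlongrightarrow> 0) at_top"
      using l by (simp add: powr_def mult.commute)
  qed
  then have "eventually (\<lambda>s. g s < 1) at_top"
    by (auto dest: order_tendstoD(2)[where a = 1])
  then obtain M where M: "g M < 1" "0 \<le> M"
    using eventually_conj[OF _ eventually_ge_at_top[of "0::real"]]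
    by (metis (mono_tags, lifting) eventually_happens trivial_limit_at_top_linorder)
  have "g 0 = (\<Sum>i=1..N. 1)" unfolding g_def by (rule sum.cong) (use L in force)+
  then have "1 \<le> g 0" using N by simp
  moreover have "continuous_on {0..M} g"
    unfolding g_def by (intro continuous_intros) (use L in force)
  ultimately obtain s where "g s = 1"
    using IVT2'[of g M 1 0] M by auto
  moreover have "t = s" if "g t = 1" for t
    using mono[of s t] mono[of t s] that \<open>g s = 1\<close> by (cases t s rule: linorder_cases) auto
  ultimately show ?thesis unfolding g_def by blast
qed

lemma inhomogeneous_attractor_ex1:
  fixes S :: "nat \<Rightarrow> 'a::metric_space \<Rightarrow> 'a"
  assumes X: "compact (UNIV :: 'a set)" and ifs: "similarity_ifs N S" and C: "compact C"
  shows "\<exists>!F. F \<noteq> {} \<and> compact F \<and> F = (\<Union>i\<in>{1..N}. S i ` F) \<union> C"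
proof -
  define \<Phi> where "\<Phi> A = (\<Union>i\<in>{1..N}. S i ` A) \<union> C" for A
  have N: "1 \<in> {1..N}" using ifs by (auto simp: similarity_ifs_def)
  have "\<forall>i\<in>{1..N}. \<exists>r. 0 < r \<and> r < 1 \<and> (\<forall>x y. dist (S i x) (S i y) = r * dist x y)"
    using ifs by (simp add: similarity_ifs_def contracting_similarity_def)
  then obtain r where r: "\<And>i. i \<in> {1..N} \<Longrightarrow> 0 < r i \<and> r i < 1"
    and S: "\<And>i x y. i \<in> {1..N} \<Longrightarrow> dist (S i x) (S i y) = r i * dist x y"
    by metis
  have mono: "A \<subseteq> B \<Longrightarrow> \<Phi> A \<subseteq> \<Phi> B" for A B unfolding \<Phi>_def by blast
  have inj: "S i x = S i y \<Longrightarrow> x = y" if "i \<in> {1..N}" for i x y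
    using S[OF that, of x y] r[OF that] by simp
  have cont: "continuous_on A (S i)" if "i \<in> {1..N}" for i A
  proof (rule lipschitz_on_continuous_on)
    show "(r i)-lipschitz_on A (S i)"
      using S[OF that] r[OF that] by (auto simp: lipschitz_on_def)
  qed
  define K where "K n = (\<Phi> ^^ n) UNIV" for n
  define F where "F = (\<Inter>n. K n)"
  have K_Suc: "K (Suc n) = \<Phi> (K n)" for n by (simp add: K_def)
  have K_decr: "K (Suc n) \<subseteq> K n" for n
    by (induction n) (auto simp: K_Suc K_def intro: subsetD[OF mono])
  have K_anti: "K n \<subseteq> K m" if "m \<le> n" for m n
    using lift_Suc_antimono_le[of K, OF K_decr that] .
  have K_compact: "compact (K n)" for n
  proof (induction n)
    case 0
    then show ?case using X by (simp add: K_def)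
  next
    case (Suc n)
    then show ?case unfolding K_Suc \<Phi>_def
      using cont C by (intro compact_Un compact_UN compact_continuous_image) auto
  qed
  have K_ne: "K n \<noteq> {}" for n
    by (induction n) (use N in \<open>auto simp: K_Suc K_def \<Phi>_def\<close>)
  have F_ne: "F \<noteq> {}"
  proof -
    have "UNIV \<inter> (\<Inter>n\<in>UNIV. K n) \<noteq> {}"
    proof (rule compact_imp_fip_image[OF X])
      fix I' :: "nat set" assume "finite I'" "I' \<subseteq> UNIV"
      then have "K (Max (insert 0 I')) \<subseteq> (\<Inter>n\<in>I'. K n)"
        using K_anti by (intro INT_greatest) auto
      then show "UNIV \<inter> (\<Inter>n\<in>I'. K n) \<noteq> {}" using K_ne by blast
    qed (use K_compact compact_imp_closed in auto)
    then show ?thesis by (simp add: F_def)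
  qed
  have "closed F" unfolding F_def using K_compact compact_imp_closed by blast
  then have F_compact: "compact F"
    using compact_Int_closed[OF X] by simp
  have F_fix: "F = \<Phi> F"
  proof
    have "\<Phi> F \<subseteq> K n" for n
      using mono[of F "K n"] K_Suc K_decr unfolding F_def by blast
    then show "\<Phi> F \<subseteq> F" unfolding F_def by blast
    show "F \<subseteq> \<Phi> F"
    proof
      fix x assume x: "x \<in> F"
      show "x \<in> \<Phi> F"
      proof (rule ccontr)
        assume nx: "x \<notin> \<Phi> F"
        have "\<exists>n. x \<notin> S i ` K n" if i: "i \<in> {1..N}" for i
        proof (rule ccontr)
          assume "\<nexists>n. x \<notin> S i ` K n"
          then have a: "\<And>n. x \<in> S i ` K n" by blast
          then obtain y where y: "x = S i y" by blast
          have "y \<in> K n" for n using a[of n] y inj[OF i] by auto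
          then show False using nx i y unfolding F_def \<Phi>_def by blast
        qed
        then obtain m where m: "\<And>i. i \<in> {1..N} \<Longrightarrow> x \<notin> S i ` K (m i)" by metis
        define M where "M = Max (m ` {1..N})"
        have "x \<notin> S i ` K M" if "i \<in> {1..N}" for i
          using m[OF that] K_anti[of "m i" M] that unfolding M_def by force
        moreover have "x \<notin> C" using nx by (auto simp: \<Phi>_def)
        ultimately have "x \<notin> K (Suc M)" unfolding K_Suc \<Phi>_def by blast
        then show False using x by (auto simp: F_def)
      qed
    qed
  qed
  have uniq: "A = F" if "A \<noteq> {}" "compact A" "A = \<Phi> A" for A
  proof
    have "A \<subseteq> K n" for n
    proof (induction n)
      case (Suc n)
      then show ?case using mono[OF Suc] that(3) by (simp add: K_Suc)
    qed (simp add: K_def)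
    then show "A \<subseteq> F" by (auto simp: F_def)
    obtain x where x: "x \<in> F" and sup: "\<And>y. y \<in> F \<Longrightarrow> infdist y A \<le> infdist x A"
      using continuous_attains_sup[OF F_compact F_ne
          continuous_on_infdist[OF continuous_on_id, where A = A]] by blast
    have clA: "closed A" using that(2) by (rule compact_imp_closed)
    have "infdist x A = 0"
    proof (cases "x \<in> C")
      case True
      then have "x \<in> A" using that(3) by (auto simp: \<Phi>_def)
      then show ?thesis by simp
    next
      case False
      then obtain i y where i: "i \<in> {1..N}" and y: "y \<in> F" "x = S i y"
        using x equalityD1[OF F_fix] unfolding \<Phi>_def by blast
      obtain a where a: "a \<in> A" "\<And>b. b \<in> A \<Longrightarrow> dist y a \<le> dist y b"
        using continuous_attains_inf[OF \<open>compact A\<close> \<open>A \<noteq> {}\<close>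
            continuous_on_dist[OF continuous_on_const continuous_on_id, of A y]] by blast
      then have "dist y a \<le> infdist y A"
        using \<open>A \<noteq> {}\<close> by (auto simp: infdist_def intro: cINF_greatest)
      have "S i a \<in> A" using a(1) i equalityD2[OF that(3)] unfolding \<Phi>_def by blast
      then have "infdist x A \<le> r i * dist y a"
        using infdist_le[of "S i a" A x] S[OF i, of y a] y by simp
      also have "\<dots> \<le> r i * infdist x A"
        using sup[OF y(1)] \<open>dist y a \<le> infdist y A\<close> r[OF i] by (intro mult_left_mono) auto
      finally have "(1 - r i) * infdist x A \<le> 0" by (simp add: algebra_simps)
      then show ?thesis
        using r[OF i] infdist_nonneg[of x A] by (auto simp: mult_le_0_iff)
    qed
    then have "infdist y A = 0" if "y \<in> F" for y
      using sup[OF that] infdist_nonneg[of y A] by simp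
    then show "F \<subseteq> A"
      using in_closed_iff_infdist_zero[OF clA \<open>A \<noteq> {}\<close>] by blast
  qed
  show ?thesis
  proof (rule ex1I[of _ F])
    show "F \<noteq> {} \<and> compact F \<and> F = (\<Union>i\<in>{1..N}. S i ` F) \<union> C"
      using F_ne F_compact F_fix by (simp add: \<Phi>_def)
    show "A = F" if "A \<noteq> {} \<and> compact A \<and> A = (\<Union>i\<in>{1..N}. S i ` A) \<union> C" for A
      using that uniq[of A] by (simp add: \<Phi>_def)
  qed
qed

corollary homogeneous_attractor_ex1:
  fixes S :: "nat \<Rightarrow> 'a::metric_space \<Rightarrow> 'a"
  assumes "compact (UNIV :: 'a set)" and "similarity_ifs N S"
  shows "\<exists>!F. F \<noteq> {} \<and> compact F \<and> F = (\<Union>i\<in>{1..N}. S i ` F)"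
  using inhomogeneous_attractor_ex1[OF assms compact_empty] by simp

lemma covering_number_attained:
  fixes E :: "'a::metric_space set"
  assumes X: "compact (UNIV :: 'a set)" and "0 < \<delta>"
  shows "\<exists>\<U>. finite \<U> \<and> card \<U> = covering_number \<delta> E \<and> E \<subseteq> \<Union>\<U> \<and>
           (\<forall>A\<in>\<U>. bounded A \<and> diameter A \<le> \<delta>)"
proof -
  obtain D where D: "finite D" "(UNIV :: 'a set) \<subseteq> (\<Union>x\<in>D. ball x (\<delta>/2))"
    by (rule compactE_image[OF X, of UNIV "\<lambda>x. ball x (\<delta>/2)"]) (use \<open>0 < \<delta>\<close> in auto)
  have "diameter (ball x (\<delta>/2)) \<le> \<delta>" for x :: 'a
  proof -
    have "dist y z \<le> \<delta>" if "y \<in> ball x (\<delta>/2)" "z \<in> ball x (\<delta>/2)" for y z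
      using that dist_triangle3[of y z x] by simp
    then show ?thesis
      using \<open>0 < \<delta>\<close> by (auto simp: diameter_def intro!: cSUP_least)
  qed
  then have "\<exists>n \<U>. finite \<U> \<and> card \<U> = n \<and> E \<subseteq> \<Union>\<U> \<and> (\<forall>A\<in>\<U>. bounded A \<and> diameter A \<le> \<delta>)"
    using D by (intro exI[of _ "card ((\<lambda>x. ball x (\<delta>/2)) ` D)"]
        exI[of _ "(\<lambda>x. ball x (\<delta>/2)) ` D"]) auto
  then show ?thesis unfolding covering_number_def by (rule LeastI_ex)
qed

end

theory Submission
  imports Defs
begin

text \<open>The inhomogeneous attractor \<open>F\<close> contains the copy \<open>S\<^sub>w(C)\<close> of \<open>C\<close> for every word \<open>w\<close>. For a scale
  \<open>\<rho> \<le> 1\<close>, stop each infinite word as soon as its contraction ratio is comparable to \<open>\<rho>\<close>; the words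
  so obtained form a cut set \<open>W\<close> of the tree of words, and since \<open>\<Sum>\<^sub>w r\<^sub>w\<^sup>s = 1\<close> on any cut set, \<open>W\<close> has
  about \<open>\<rho>\<^sup>-\<^sup>s\<close> elements. Each copy \<open>S\<^sub>w(C)\<close> with \<open>w\<close> in \<open>W\<close> needs at least \<open>N(\<delta>/\<rho>, C)\<close> sets of
  diameter at most \<open>\<delta>\<close> to cover it. For \<open>\<delta> \<le> \<rho>\<close>, no such set meets more than a constant number of
  copies, so double counting yields

  \<open>N(\<delta>, F) \<ge> c \<rho>\<^sup>-\<^sup>s N(\<delta>/\<rho>, C)\<close>  (lemma \<open>covering_number_ge\<close>).

  Taking \<open>\<rho> = \<delta>\<^sup>1\<^sup>-\<^sup>p\<close> with \<open>N(\<delta>\<^sup>p, C) \<ge> \<delta>\<^sup>-\<^sup>p\<^sup>t\<close> gives \<open>N(\<delta>, F) \<ge> c \<delta>\<close> to the power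
  \<open>- (p t + (1 - p) s)\<close>, and the bound on the lower box dimension follows by letting \<open>p\<close> tend to the supremum. When
  \<open>t < s\<close> the lower limit of the exponents points the wrong way, but then the choice \<open>p = 0\<close> already
  gives the lower bound \<open>s\<close>, which is at least the one claimed.

  The bounded multiplicity (lemma \<open>pieces_meeting_bounded\<close>) is where the geometry enters. Choose a
  compact ball \<open>K\<close> inside the open set \<open>U\<close> of the open set condition. The sets \<open>S\<^sub>w(K)\<close>, \<open>w\<close> in \<open>W\<close>,
  are disjoint and have Hausdorff measure at least a constant times \<open>\<rho>\<^sup>d\<close>, where \<open>d\<close> is the dimension
  of the space. All those whose copy of \<open>C\<close> meets a given set of diameter at most \<open>\<rho>\<close> lie in one ball of
  radius comparable to \<open>\<rho>\<close>, whose measure is at most a constant times \<open>\<rho>\<^sup>d\<close> by Ahlfors regularity; so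
  there is a bounded number of them. Being compact and disjoint, the sets \<open>S\<^sub>w(K)\<close> are positively
  separated, and the additivity of Hausdorff measure on such sets follows directly from its definition.

  For the strict inequality, cut sets also give \<open>N(\<delta>, E) \<le> c \<delta>\<^sup>-\<^sup>s\<close> for the homogeneous attractor \<open>E\<close>,
  so its lower box dimension is at most \<open>s\<close>; the hypothesis on \<open>t\<close> says exactly that
  \<open>p t + (1 - p) s\<close> exceeds both \<open>s\<close> and the lower box dimension of \<open>C\<close>.\<close>

section \<open>Similarities\<close>

text \<open>The ratio is an argument so that it can be tracked through compositions; it may be 1, as for the
  empty composition.\<close>

definition scales_by :: "real \<Rightarrow> ('a::metric_space \<Rightarrow> 'a) \<Rightarrow> bool" where
  "scales_by r f \<longleftrightarrow> 0 < r \<and> (\<forall>x y. dist (f x) (f y) = r * dist x y)"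

lemma scales_by_id: "scales_by 1 id"
  by (simp add: scales_by_def)

lemma scales_by_comp:
  assumes "scales_by r f" "scales_by q g"
  shows "scales_by (r * q) (f \<circ> g)"
  using assms by (simp add: scales_by_def)

lemma scales_by_funpow:
  assumes "scales_by r f"
  shows "scales_by (r ^ n) (f ^^ n)"
proof (induction n)
  case 0
  then show ?case using scales_by_id by (simp add: id_def)
next
  case (Suc n)
  then show ?case using scales_by_comp[OF assms Suc] by (simp add: comp_def)
qed

lemma scales_by_inj: "scales_by r f \<Longrightarrow> inj f"
  unfolding scales_by_def inj_def by (metis dist_eq_0_iff mult_eq_0_iff less_irrefl)

lemma diameter_leI:
  assumes "\<And>x y. x \<in> A \<Longrightarrow> y \<in> A \<Longrightarrow> dist x y \<le> \<delta>" "0 \<le> \<delta>"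
  shows "diameter A \<le> \<delta>"
  using assms by (auto simp: diameter_def intro!: cSUP_least)

lemma scales_by_vimage_diameter:
  assumes f: "scales_by r f" and B: "bounded B"
  shows "bounded (f -` B)" "diameter (f -` B) \<le> diameter B / r"
proof -
  have r: "0 < r" and d: "\<And>x y. dist (f x) (f y) = r * dist x y"
    using f by (auto simp: scales_by_def)
  have *: "dist x y \<le> diameter B / r" if "x \<in> f -` B" "y \<in> f -` B" for x y
    using diameter_bounded_bound[OF B, of "f x" "f y"] that d[of x y] r
    by (simp add: field_simps)
  then show "bounded (f -` B)"
    unfolding bounded_two_points by blast
  show "diameter (f -` B) \<le> diameter B / r"
    by (rule diameter_leI[OF *]) (use r diameter_ge_0[OF B] in auto)
qed

lemma scales_by_image_diameter:
  assumes f: "scales_by r f" and B: "bounded B"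
  shows "bounded (f ` B)" "diameter (f ` B) \<le> r * diameter B"
proof -
  have r: "0 < r" and d: "\<And>x y. dist (f x) (f y) = r * dist x y"
    using f by (auto simp: scales_by_def)
  have *: "dist x y \<le> r * diameter B" if xy: "x \<in> f ` B" "y \<in> f ` B" for x y
  proof -
    obtain u v where "u \<in> B" "v \<in> B" "x = f u" "y = f v" using xy by blast
    then show ?thesis using diameter_bounded_bound[OF B, of u v] d[of u v] r by simp
  qed
  then show "bounded (f ` B)"
    unfolding bounded_two_points by blast
  show "diameter (f ` B) \<le> r * diameter B"
    by (rule diameter_leI[OF *]) (use r diameter_ge_0[OF B] in auto)
qed

lemma scales_by_continuous: "scales_by r f \<Longrightarrow> continuous_on A f"
  by (rule lipschitz_on_continuous_on[of r]) (auto simp: scales_by_def lipschitz_on_def)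

section \<open>Hausdorff measure under similarities and on separated sets\<close>

lemma diam_power_mono:
  assumes "A \<subseteq> B" "bounded B" "0 \<le> s"
  shows "diam_power s A \<le> diam_power s B"
  using assms diameter_subset[OF assms(1,2)] diameter_ge_0[OF bounded_subset[OF assms(2,1)]]
  by (auto simp: diam_power_def intro!: ennreal_leI powr_mono2)

text \<open>Pulling a cover back along a similarity costs the factor \<open>r\<^sup>-\<^sup>s\<close> in each summand; covering sets
  outside the range have empty preimage and contribute 0.\<close>

lemma diam_power_vimage:
  assumes f: "scales_by r f" and B: "bounded B" and s: "0 \<le> s"
  shows "ennreal (r powr s) * diam_power s (f -` B) \<le> diam_power s B"
proof (cases "f -` B = {} \<or> s = 0")
  case True
  then show ?thesis using f by (auto simp: diam_power_def scales_by_def)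
next
  case False
  then have ne: "f -` B \<noteq> {}" "B \<noteq> {}" "s \<noteq> 0" by auto
  have r: "0 < r" using f by (simp add: scales_by_def)
  note v = scales_by_vimage_diameter[OF f B]
  have "r powr s * diameter (f -` B) powr s = (r * diameter (f -` B)) powr s"
    using r diameter_ge_0[OF v(1)] by (simp add: powr_mult)
  also have "\<dots> \<le> diameter B powr s"
    using v(2) r diameter_ge_0[OF v(1)] s by (intro powr_mono2) (auto simp: field_simps)
  finally show ?thesis
    using ne by (simp add: diam_power_def ennreal_mult[symmetric] ennreal_leI)
qed

lemma hausdorff_premeasure_antimono:
  assumes "\<delta> \<le> \<epsilon>"
  shows "hausdorff_premeasure s \<epsilon> E \<le> hausdorff_premeasure s \<delta> E"
  unfolding hausdorff_premeasure_def by (rule INF_superset_mono) (use assms in \<open>auto intro: order_trans\<close>)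

lemma hausdorff_premeasure_le_measure:
  "0 < \<delta> \<Longrightarrow> hausdorff_premeasure s \<delta> E \<le> hausdorff_measure s E"
  unfolding hausdorff_measure_def by (rule SUP_upper) auto

lemma hausdorff_measure_mono:
  assumes "A \<subseteq> B"
  shows "hausdorff_measure s A \<le> hausdorff_measure s B"
proof -
  have "hausdorff_premeasure s \<delta> A \<le> hausdorff_premeasure s \<delta> B" for \<delta>
    unfolding hausdorff_premeasure_def by (rule INF_superset_mono) (use assms in auto)
  then show ?thesis unfolding hausdorff_measure_def by (intro SUP_mono) auto
qed

text \<open>Every cover of \<open>f ` A\<close> pulls back to a cover of \<open>A\<close>. This bounds the measure of small pieces
  from below, and that of large balls from above by shrinking them.\<close>

lemma hausdorff_measure_image_ge:
  assumes f: "scales_by r f" and s: "0 \<le> s"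
  shows "ennreal (r powr s) * hausdorff_measure s A \<le> hausdorff_measure s (f ` A)"
proof -
  have r: "0 < r" using f by (simp add: scales_by_def)
  have "ennreal (r powr s) * hausdorff_premeasure s \<delta> A \<le> hausdorff_measure s (f ` A)"
    if \<delta>: "0 < \<delta>" for \<delta>
  proof -
    have "ennreal (r powr s) * hausdorff_premeasure s \<delta> A \<le> hausdorff_premeasure s (r * \<delta>) (f ` A)"
      unfolding hausdorff_premeasure_def[of s "r * \<delta>"]
    proof (rule INF_greatest)
      fix B :: "nat \<Rightarrow> 'a set"
      assume "B \<in> {B. f ` A \<subseteq> (\<Union>n. B n) \<and> (\<forall>n. bounded (B n) \<and> diameter (B n) \<le> r * \<delta>)}"
      then have B: "f ` A \<subseteq> (\<Union>n. B n)" "\<And>n. bounded (B n)" "\<And>n. diameter (B n) \<le> r * \<delta>"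
        by auto
      have "diameter (f -` B n) \<le> \<delta>" for n
      proof -
        have "diameter (f -` B n) \<le> diameter (B n) / r"
          by (rule scales_by_vimage_diameter[OF f B(2)])
        also have "\<dots> \<le> \<delta>" using B(3)[of n] r by (simp add: field_simps)
        finally show ?thesis .
      qed
      then have "hausdorff_premeasure s \<delta> A \<le> (\<Sum>n. diam_power s (f -` B n))"
        unfolding hausdorff_premeasure_def
      proof (intro INF_lower CollectI conjI allI)
        show "A \<subseteq> (\<Union>n. f -` B n)" using B(1) by blast
      qed (use scales_by_vimage_diameter(1)[OF f B(2)] in auto)
      then have "ennreal (r powr s) * hausdorff_premeasure s \<delta> A
          \<le> ennreal (r powr s) * (\<Sum>n. diam_power s (f -` B n))"
        by (intro mult_left_mono) auto
      also have "\<dots> = (\<Sum>n. ennreal (r powr s) * diam_power s (f -` B n))" by simp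
      also have "\<dots> \<le> (\<Sum>n. diam_power s (B n))"
        by (intro suminf_le diam_power_vimage[OF f B(2) s]) auto
      finally show "ennreal (r powr s) * hausdorff_premeasure s \<delta> A \<le> (\<Sum>n. diam_power s (B n))" .
    qed
    also have "\<dots> \<le> hausdorff_measure s (f ` A)"
      using r \<delta> by (intro hausdorff_premeasure_le_measure) simp
    finally show ?thesis .
  qed
  then show ?thesis
    unfolding hausdorff_measure_def[of s A] SUP_mult_left_ennreal by (intro SUP_least) auto
qed

text \<open>A covering set of diameter less than the gap \<open>g\<close> meets only one of \<open>A\<close> and \<open>B\<close>, so a fine cover of
  the union splits into covers of the two parts.\<close>

lemma hausdorff_measure_Un_separated:
  assumes g: "0 < g" "\<And>x y. x \<in> A \<Longrightarrow> y \<in> B \<Longrightarrow> g \<le> dist x y" and s: "0 \<le> s"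
  shows "hausdorff_measure s A + hausdorff_measure s B \<le> hausdorff_measure s (A \<union> B)"
proof -
  let ?P = "hausdorff_premeasure s"
  have small: "?P \<delta> A + ?P \<delta> B \<le> ?P \<delta> (A \<union> B)" if \<delta>: "0 < \<delta>" "\<delta> < g" for \<delta>
    unfolding hausdorff_premeasure_def[of s \<delta> "A \<union> B"]
  proof (rule INF_greatest)
    fix V :: "nat \<Rightarrow> 'a set"
    assume "V \<in> {V. A \<union> B \<subseteq> (\<Union>n. V n) \<and> (\<forall>n. bounded (V n) \<and> diameter (V n) \<le> \<delta>)}"
    then have V: "A \<union> B \<subseteq> (\<Union>n. V n)" "\<And>n. bounded (V n)" "\<And>n. diameter (V n) \<le> \<delta>"
      by auto
    have cov: "?P \<delta> D \<le> (\<Sum>n. diam_power s (V n \<inter> D))" if "D \<subseteq> A \<union> B" for D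
      unfolding hausdorff_premeasure_def
    proof (rule INF_lower, safe)
      fix x assume "x \<in> D"
      then show "x \<in> (\<Union>n. V n \<inter> D)" using that V(1) by blast
    next
      fix n
      show "bounded (V n \<inter> D)" using V(2) by (simp add: bounded_Int)
      show "diameter (V n \<inter> D) \<le> \<delta>"
        using diameter_subset[OF Int_lower1[of "V n" D] V(2)] V(3)[of n] by linarith
    qed
    have split: "diam_power s (V n \<inter> A) + diam_power s (V n \<inter> B) \<le> diam_power s (V n)" for n
    proof -
      have "V n \<inter> A = {} \<or> V n \<inter> B = {}"
      proof (rule ccontr)
        assume "\<not> ?thesis"
        then obtain x y where "x \<in> V n" "x \<in> A" "y \<in> V n" "y \<in> B" by blast
        then show False
          using g(2)[of x y] diameter_bounded_bound[OF V(2), of x n y] V(3)[of n] \<delta> by linarith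
      qed
      moreover have "diam_power s (V n \<inter> D) \<le> diam_power s (V n)" for D
        by (rule diam_power_mono[OF _ V(2) s]) auto
      moreover have "diam_power s {} = 0" by (simp add: diam_power_def)
      ultimately show ?thesis by (metis add.left_neutral add.right_neutral)
    qed
    have "?P \<delta> A + ?P \<delta> B \<le> (\<Sum>n. diam_power s (V n \<inter> A)) + (\<Sum>n. diam_power s (V n \<inter> B))"
      by (intro add_mono cov) auto
    also have "\<dots> = (\<Sum>n. diam_power s (V n \<inter> A) + diam_power s (V n \<inter> B))"
      by (rule suminf_add) auto
    also have "\<dots> \<le> (\<Sum>n. diam_power s (V n))"
      by (intro suminf_le split) auto
    finally show "?P \<delta> A + ?P \<delta> B \<le> (\<Sum>n. diam_power s (V n))" .
  qed
  have "hausdorff_measure s A + hausdorff_measure s B = (SUP \<delta>\<in>{0<..}. ?P \<delta> A + ?P \<delta> B)"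
    unfolding hausdorff_measure_def
  proof (rule SUP_add_directed_ennreal[symmetric])
    fix i j :: real assume "i \<in> {0<..}" "j \<in> {0<..}"
    then show "\<exists>k\<in>{0<..}. ?P i A + ?P j B \<le> ?P k A + ?P k B"
      by (intro bexI[of _ "min i j"] add_mono hausdorff_premeasure_antimono) auto
  qed
  also have "\<dots> \<le> hausdorff_measure s (A \<union> B)"
  proof (rule SUP_least)
    fix \<delta> :: real assume "\<delta> \<in> {0<..}"
    define \<epsilon> where "\<epsilon> = min \<delta> (g / 2)"
    have \<epsilon>: "0 < \<epsilon>" "\<epsilon> < g" "\<epsilon> \<le> \<delta>" using \<open>\<delta> \<in> {0<..}\<close> g(1) by (auto simp: \<epsilon>_def)
    have "?P \<delta> A + ?P \<delta> B \<le> ?P \<epsilon> A + ?P \<epsilon> B"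
      by (intro add_mono hausdorff_premeasure_antimono \<epsilon>)
    also have "\<dots> \<le> ?P \<epsilon> (A \<union> B)" by (rule small[OF \<epsilon>(1,2)])
    also have "\<dots> \<le> hausdorff_measure s (A \<union> B)"
      by (rule hausdorff_premeasure_le_measure[OF \<epsilon>(1)])
    finally show "?P \<delta> A + ?P \<delta> B \<le> hausdorff_measure s (A \<union> B)" .
  qed
  finally show ?thesis .
qed

text \<open>The distance attains its minimum on the compact product \<open>A \<times> B\<close>.\<close>

lemma disjoint_compact_separated:
  fixes A B :: "'a::metric_space set"
  assumes "compact A" "compact B" "A \<inter> B = {}"
  obtains g where "0 < g" "\<forall>x\<in>A. \<forall>y\<in>B. g \<le> dist x y"
proof (cases "A \<times> B = {}")
  case True
  then show ?thesis using that[of 1] by auto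
next
  case False
  have "continuous_on (A \<times> B) (\<lambda>p. dist (fst p) (snd p))" by (intro continuous_intros)
  then obtain p where p: "p \<in> A \<times> B" "\<And>q. q \<in> A \<times> B \<Longrightarrow> dist (fst p) (snd p) \<le> dist (fst q) (snd q)"
    using continuous_attains_inf[OF compact_Times[OF assms(1,2)] False] by blast
  show ?thesis
  proof (rule that)
    show "0 < dist (fst p) (snd p)" using p(1) assms(3) by auto
    show "\<forall>x\<in>A. \<forall>y\<in>B. dist (fst p) (snd p) \<le> dist x y" using p(2) by force
  qed
qed

lemma hausdorff_measure_disjoint_compact:
  assumes "finite I" "\<And>i. i \<in> I \<Longrightarrow> compact (K i)" "disjoint_family_on K I" "0 \<le> s"
  shows "(\<Sum>i\<in>I. hausdorff_measure s (K i)) \<le> hausdorff_measure s (\<Union>i\<in>I. K i)"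
  using assms
proof (induction I rule: finite_induct)
  case empty
  then show ?case by simp
next
  case (insert i I)
  have "compact (K i)" "compact (\<Union>j\<in>I. K j)" "K i \<inter> (\<Union>j\<in>I. K j) = {}"
    using insert by (auto simp: disjoint_family_on_def)
  then obtain g where "0 < g" "\<forall>x\<in>K i. \<forall>y\<in>(\<Union>j\<in>I. K j). g \<le> dist x y"
    by (rule disjoint_compact_separated)
  then have "hausdorff_measure s (K i) + hausdorff_measure s (\<Union>j\<in>I. K j)
      \<le> hausdorff_measure s (K i \<union> (\<Union>j\<in>I. K j))"
    by (intro hausdorff_measure_Un_separated[of g] insert.prems) auto
  moreover have "(\<Sum>j\<in>I. hausdorff_measure s (K j)) \<le> hausdorff_measure s (\<Union>j\<in>I. K j)"
    using insert by (auto simp: disjoint_family_on_def)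
  ultimately show ?case
    using insert(1,2) by (simp add: order_trans[OF add_left_mono])
qed

text \<open>The upper bound of Ahlfors regularity extends from small radii to all radii: a large ball is mapped
  into a small one by an iterate of a contracting similarity, and both sides scale in the same way.\<close>

lemma hausdorff_measure_ball_le:
  fixes f :: "'a::metric_space \<Rightarrow> 'a" and x :: 'a
  assumes f: "scales_by r f" and r1: "r < 1" and d: "0 \<le> d" and D: "0 < D" and c: "0 \<le> c"
    and H: "\<And>(x::'a) R. 0 < R \<Longrightarrow> R \<le> D \<Longrightarrow> hausdorff_measure d (ball x R) \<le> ennreal (c * R powr d)"
    and R: "0 < R"
  shows "hausdorff_measure d (ball x R) \<le> ennreal (c * R powr d)"
proof -
  have r: "0 < r" using f by (simp add: scales_by_def)
  obtain n where n: "r ^ n < D / R" using real_arch_pow_inv[of "D / R" r] D R r1 by auto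
  let ?q = "r ^ n" and ?g = "f ^^ n"
  have g: "scales_by ?q ?g" by (rule scales_by_funpow[OF f])
  have q: "0 < ?q" using r by simp
  have "ennreal (?q powr d) * hausdorff_measure d (ball x R) \<le> hausdorff_measure d (?g ` ball x R)"
    by (rule hausdorff_measure_image_ge[OF g d])
  also have "\<dots> \<le> hausdorff_measure d (ball (?g x) (?q * R))"
    using g q by (intro hausdorff_measure_mono) (auto simp: scales_by_def)
  also have "\<dots> \<le> ennreal (c * (?q * R) powr d)"
    using n R q by (intro H) (auto simp: field_simps)
  also have "\<dots> = ennreal (?q powr d) * ennreal (c * R powr d)"
    using q R c by (simp add: powr_mult ennreal_mult[symmetric] mult_ac)
  finally have le: "ennreal (?q powr d) * hausdorff_measure d (ball x R)
      \<le> ennreal (?q powr d) * ennreal (c * R powr d)" .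
  have "ennreal (?q powr d) \<noteq> 0" using r by simp
  then show ?thesis
    using le by (simp only: ennreal_mult_le_mult_iff ennreal_neq_top simp_thms)
qed

section \<open>Covering numbers\<close>

lemma covering_number_le_card:
  assumes "finite \<U>" "E \<subseteq> \<Union>\<U>" "\<And>A. A \<in> \<U> \<Longrightarrow> bounded A \<and> diameter A \<le> \<delta>"
  shows "covering_number \<delta> E \<le> card \<U>"
  unfolding covering_number_def by (rule Least_le) (use assms in blast)

lemma covering_number_pos:
  fixes E :: "'a::metric_space set"
  assumes "compact (UNIV :: 'a set)" "0 < \<delta>" "E \<noteq> {}"
  shows "1 \<le> covering_number \<delta> E"
proof -
  obtain \<U> where "finite \<U>" "card \<U> = covering_number \<delta> E" "E \<subseteq> \<Union>\<U>"
    using covering_number_attained[OF assms(1,2)] by blast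
  then show ?thesis using assms(3) by (cases "\<U> = {}") (auto simp: Suc_le_eq card_gt_0_iff)
qed

section \<open>Words and cut sets\<close>

primrec word_map :: "(nat \<Rightarrow> 'a \<Rightarrow> 'a) \<Rightarrow> nat list \<Rightarrow> 'a \<Rightarrow> 'a" where
  "word_map S [] = id"
| "word_map S (i # w) = S i \<circ> word_map S w"

primrec word_ratio :: "(nat \<Rightarrow> 'a::metric_space \<Rightarrow> 'a) \<Rightarrow> nat list \<Rightarrow> real" where
  "word_ratio S [] = 1"
| "word_ratio S (i # w) = Lip (S i) * word_ratio S w"

text \<open>Every infinite word over \<open>{1..N}\<close> has exactly one prefix in a cut set. Finite cut sets arise from
  \<open>{[]}\<close> by branching at the first letter; this form makes the self-similarity arguments
  below rule inductions.\<close>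

inductive cut_set :: "nat \<Rightarrow> nat list set \<Rightarrow> bool" for N where
  root: "cut_set N {[]}"
| branch: "(\<And>i. i \<in> {1..N} \<Longrightarrow> cut_set N (W i)) \<Longrightarrow> cut_set N (\<Union>i\<in>{1..N}. (#) i ` W i)"

lemma cut_set_finite: "cut_set N W \<Longrightarrow> finite W"
  by (induction rule: cut_set.induct) auto

lemma cut_set_words: "cut_set N W \<Longrightarrow> w \<in> W \<Longrightarrow> set w \<subseteq> {1..N}"
proof (induction arbitrary: w rule: cut_set.induct)
  case (branch W)
  then obtain i v where "i \<in> {1..N}" "v \<in> W i" "w = i # v" by blast
  then show ?case using branch.IH by auto
qed simp

lemma word_map_invariant:
  assumes "\<And>i. i \<in> {1..N} \<Longrightarrow> S i ` E \<subseteq> E" "set w \<subseteq> {1..N}"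
  shows "word_map S w ` E \<subseteq> E"
  using assms(2)
proof (induction w)
  case (Cons i w)
  then have "S i ` word_map S w ` E \<subseteq> S i ` E" "S i ` E \<subseteq> E"
    using assms(1) by (auto intro!: image_mono)
  then show ?case by (simp add: image_comp)
qed simp

lemma cut_set_covers:
  assumes "cut_set N W" and E: "E \<subseteq> (\<Union>i\<in>{1..N}. S i ` E)"
  shows "E \<subseteq> (\<Union>w\<in>W. word_map S w ` E)"
  using assms(1)
proof (induction rule: cut_set.induct)
  case root
  then show ?case by simp
next
  case (branch W)
  show ?case
  proof
    fix x assume "x \<in> E"
    then obtain i y where i: "i \<in> {1..N}" "y \<in> E" "x = S i y" using E by blast
    then obtain w z where "w \<in> W i" "z \<in> E" "y = word_map S w z"
      using branch.IH[OF i(1)] by blast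
    then have "i # w \<in> (\<Union>i\<in>{1..N}. (#) i ` W i)" "x = word_map S (i # w) z" "z \<in> E"
      using i by auto
    then show "x \<in> (\<Union>w\<in>(\<Union>i\<in>{1..N}. (#) i ` W i). word_map S w ` E)" by blast
  qed
qed

text \<open>At the first letter where two words of a cut set differ, their images are separated by the
  disjointness of the sets \<open>S\<^sub>i(U)\<close>; injectivity transports this through the common prefix.\<close>

lemma cut_set_disjoint:
  assumes "cut_set N W" and inv: "\<And>i. i \<in> {1..N} \<Longrightarrow> S i ` U \<subseteq> U"
    and disj: "disjoint_family_on (\<lambda>i. S i ` U) {1..N}"
    and inj: "\<And>i. i \<in> {1..N} \<Longrightarrow> inj (S i)"
  shows "disjoint_family_on (\<lambda>w. word_map S w ` U) W"
  using assms(1)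
proof (induction rule: cut_set.induct)
  case root
  then show ?case by (simp add: disjoint_family_on_def)
next
  case (branch W)
  show ?case
    unfolding disjoint_family_on_def
  proof (intro ballI impI)
    fix v' w' assume *: "v' \<in> (\<Union>i\<in>{1..N}. (#) i ` W i)" "w' \<in> (\<Union>i\<in>{1..N}. (#) i ` W i)"
      and ne: "v' \<noteq> w'"
    obtain i v where v: "v' = i # v" "i \<in> {1..N}" "v \<in> W i" using *(1) by blast
    obtain j w where w: "w' = j # w" "j \<in> {1..N}" "w \<in> W j" using *(2) by blast
    have im: "word_map S (i # v) ` U = S i ` word_map S v ` U" for i v by (simp add: image_comp)
    show "word_map S v' ` U \<inter> word_map S w' ` U = {}"
    proof (cases "i = j")
      case True
      then have "word_map S v ` U \<inter> word_map S w ` U = {}"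
        using branch.IH[OF v(2)] v w ne unfolding disjoint_family_on_def by blast
      then show ?thesis
        using inj[OF v(2)] True unfolding v(1) w(1) im by (simp add: image_Int[symmetric])
    next
      case False
      have "word_map S v ` U \<subseteq> U" "word_map S w ` U \<subseteq> U"
        using word_map_invariant[OF inv] cut_set_words[OF branch.hyps[OF v(2)] v(3)]
          cut_set_words[OF branch.hyps[OF w(2)] w(3)] by auto
      moreover have "S i ` U \<inter> S j ` U = {}"
        using disj v(2) w(2) False unfolding disjoint_family_on_def by blast
      ultimately show ?thesis unfolding v(1) w(1) im by blast
    qed
  qed
qed

text \<open>Give the infinite words starting with \<open>w\<close> the weight \<open>r\<^sub>w\<^sup>s\<close>: this is a probability measure on infinite
  words, and a cut set partitions them.\<close>

lemma cut_set_sum: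
  fixes S :: "nat \<Rightarrow> 'a::metric_space \<Rightarrow> 'a"
  assumes "cut_set N W" and L: "\<And>i. i \<in> {1..N} \<Longrightarrow> 0 < Lip (S i)"
    and sum: "(\<Sum>i=1..N. Lip (S i) powr s) = 1"
  shows "(\<Sum>w\<in>W. word_ratio S w powr s) = 1"
  using assms(1)
proof (induction rule: cut_set.induct)
  case root
  then show ?case by simp
next
  case (branch W)
  have pos: "0 < word_ratio S w" if "set w \<subseteq> {1..N}" for w
    using that by (induction w) (use L in auto)
  have "(\<Sum>w\<in>(\<Union>i\<in>{1..N}. (#) i ` W i). word_ratio S w powr s)
      = (\<Sum>i=1..N. \<Sum>w\<in>(#) i ` W i. word_ratio S w powr s)"
    using cut_set_finite[OF branch.hyps] by (intro sum.UNION_disjoint) auto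
  also have "\<dots> = (\<Sum>i=1..N. \<Sum>w\<in>W i. Lip (S i) powr s * word_ratio S w powr s)"
  proof (rule sum.cong[OF refl])
    fix i assume i: "i \<in> {1..N}"
    have "(\<Sum>w\<in>(#) i ` W i. word_ratio S w powr s) = (\<Sum>w\<in>W i. word_ratio S (i # w) powr s)"
      by (subst sum.reindex) (auto simp: inj_on_def)
    also have "\<dots> = (\<Sum>w\<in>W i. Lip (S i) powr s * word_ratio S w powr s)"
      using L[OF i] pos[OF cut_set_words[OF branch.hyps[OF i]]]
      by (intro sum.cong) (auto simp: powr_mult less_imp_le)
    finally show "(\<Sum>w\<in>(#) i ` W i. word_ratio S w powr s)
        = (\<Sum>w\<in>W i. Lip (S i) powr s * word_ratio S w powr s)" .
  qed
  also have "\<dots> = (\<Sum>i=1..N. Lip (S i) powr s * (\<Sum>w\<in>W i. word_ratio S w powr s))"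
    by (simp add: sum_distrib_left)
  also have "\<dots> = (\<Sum>i=1..N. Lip (S i) powr s)"
    by (intro sum.cong refl) (simp add: branch.IH)
  finally show ?case using sum by simp
qed

text \<open>In a one-point space every number in \<open>(0,1)\<close> is a contraction ratio of the only map, hence the
  requirement of two points.\<close>

locale similarity_system =
  fixes S :: "nat \<Rightarrow> 'a::metric_space \<Rightarrow> 'a" and N :: nat
  assumes compact_space: "compact (UNIV :: 'a set)"
    and ifs: "similarity_ifs N S"
    and nontrivial: "\<exists>a b :: 'a. a \<noteq> b"
begin

abbreviation s :: real where "s \<equiv> similarity_dim N S"

definition min_ratio :: real where "min_ratio = Min ((\<lambda>i. Lip (S i)) ` {1..N})"

lemma N_pos: "1 \<le> N"
  using ifs by (simp add: similarity_ifs_def)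

lemma Lip_bounds: "i \<in> {1..N} \<Longrightarrow> 0 < Lip (S i)" "i \<in> {1..N} \<Longrightarrow> Lip (S i) < 1"
proof -
  obtain a b :: 'a where "a \<noteq> b" using nontrivial by blast
  then show "i \<in> {1..N} \<Longrightarrow> 0 < Lip (S i)" "i \<in> {1..N} \<Longrightarrow> Lip (S i) < 1"
    using Lip_similarity ifs unfolding similarity_ifs_def by blast+
qed

lemma scales: "i \<in> {1..N} \<Longrightarrow> scales_by (Lip (S i)) (S i)"
proof -
  assume i: "i \<in> {1..N}"
  obtain a b :: 'a where "a \<noteq> b" using nontrivial by blast
  moreover have "contracting_similarity (S i)" using ifs i by (simp add: similarity_ifs_def)
  ultimately show ?thesis using Lip_similarity unfolding scales_by_def by blast
qed

lemma scales_word: "set w \<subseteq> {1..N} \<Longrightarrow> scales_by (word_ratio S w) (word_map S w)"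
proof (induction w)
  case (Cons i w)
  then show ?case using scales_by_comp[OF scales[of i]] by (simp add: comp_def)
qed (simp add: scales_by_id)

lemma sum_Lip: "(\<Sum>i=1..N. Lip (S i) powr s) = 1"
proof -
  obtain a b :: 'a where "a \<noteq> b" using nontrivial by blast
  from theI'[OF similarity_dim_ex1[OF ifs this]] show ?thesis by (simp add: similarity_dim_def)
qed

lemma s_nonneg: "0 \<le> s"
proof (rule ccontr)
  assume "\<not> 0 \<le> s"
  have "(\<Sum>i=1..N. (1::real)) < (\<Sum>i=1..N. Lip (S i) powr s)"
  proof (rule sum_strict_mono)
    fix i assume "i \<in> {1..N}"
    then have "Lip (S i) powr 0 < Lip (S i) powr s"
      using Lip_bounds \<open>\<not> 0 \<le> s\<close> by (intro powr_less_mono') auto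
    then show "1 < Lip (S i) powr s" using Lip_bounds(1)[OF \<open>i \<in> {1..N}\<close>] by simp
  qed (use N_pos in auto)
  then show False using sum_Lip N_pos by simp
qed

lemma min_ratio: "0 < min_ratio" "min_ratio < 1" "i \<in> {1..N} \<Longrightarrow> min_ratio \<le> Lip (S i)"
proof -
  have "min_ratio \<in> (\<lambda>i. Lip (S i)) ` {1..N}"
    unfolding min_ratio_def using N_pos by (intro Min_in) auto
  then show "0 < min_ratio" "min_ratio < 1" using Lip_bounds by auto
qed (simp add: min_ratio_def)

text \<open>Stop each word at the first moment when its ratio is at most \<open>\<sigma>\<close>: the last letter shrinks the ratio
  by a factor no smaller than \<open>min_ratio\<close>. If \<open>\<sigma> \<ge> 1\<close> the empty word, of ratio 1, is stopped
  immediately, which accounts for the minimum with 1.\<close>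

lemma cut_set_exists:
  assumes "0 < \<sigma>"
  shows "\<exists>W. cut_set N W \<and> (\<forall>w\<in>W. min 1 (min_ratio * \<sigma>) \<le> word_ratio S w \<and> word_ratio S w \<le> \<sigma>)"
proof -
  define q where "q = Max ((\<lambda>i. Lip (S i)) ` {1..N})"
  have q_in: "q \<in> (\<lambda>i. Lip (S i)) ` {1..N}" unfolding q_def using N_pos by (intro Max_in) auto
  then have q: "0 < q" "q < 1" using Lip_bounds by auto
  have q_max: "Lip (S i) \<le> q" if "i \<in> {1..N}" for i using that by (simp add: q_def)
  \<comment> \<open>Words of length \<open>n\<close> have ratio at most \<open>q ^ n\<close>, so \<open>n\<close> bounds the depth of the cut set.\<close>
  have "\<exists>W. cut_set N W \<and> (\<forall>w\<in>W. min 1 (min_ratio * \<sigma>) \<le> word_ratio S w \<and> word_ratio S w \<le> \<sigma>)"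
    if "q ^ n \<le> \<sigma>" for n \<sigma>
    using that
  proof (induction n arbitrary: \<sigma>)
    case 0
    then show ?case by (intro exI[of _ "{[]}"]) (auto intro: cut_set.root)
  next
    case (Suc n)
    show ?case
    proof (cases "1 \<le> \<sigma>")
      case True
      then show ?thesis by (intro exI[of _ "{[]}"]) (auto intro: cut_set.root)
    next
      case False
      have "\<exists>W. cut_set N W \<and> (\<forall>w\<in>W. min 1 (min_ratio * (\<sigma> / Lip (S i))) \<le> word_ratio S w \<and>
          word_ratio S w \<le> \<sigma> / Lip (S i))" if i: "i \<in> {1..N}" for i
      proof (rule Suc.IH)
        have "Lip (S i) * q ^ n \<le> q * q ^ n" using q_max[OF i] q by (intro mult_right_mono) auto
        also have "\<dots> \<le> \<sigma>" using Suc.prems by simp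
        finally show "q ^ n \<le> \<sigma> / Lip (S i)" using Lip_bounds(1)[OF i] by (simp add: field_simps)
      qed
      then obtain W where W: "\<And>i. i \<in> {1..N} \<Longrightarrow> cut_set N (W i)"
        and lo: "\<And>i w. i \<in> {1..N} \<Longrightarrow> w \<in> W i \<Longrightarrow> min 1 (min_ratio * (\<sigma> / Lip (S i))) \<le> word_ratio S w"
        and up: "\<And>i w. i \<in> {1..N} \<Longrightarrow> w \<in> W i \<Longrightarrow> word_ratio S w \<le> \<sigma> / Lip (S i)"
        by metis
      have "min 1 (min_ratio * \<sigma>) \<le> word_ratio S (i # w) \<and> word_ratio S (i # w) \<le> \<sigma>"
        if i: "i \<in> {1..N}" and w: "w \<in> W i" for i w
      proof
        note L = Lip_bounds(1)[OF i]
        show "word_ratio S (i # w) \<le> \<sigma>" using up[OF i w] L by (simp add: field_simps)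
        have "min_ratio * \<sigma> \<le> min_ratio * 1" using False min_ratio(1) by (intro mult_left_mono) auto
        then have "min_ratio * \<sigma> \<le> Lip (S i)" using min_ratio(3)[OF i] by linarith
        then have "min_ratio * \<sigma> \<le> Lip (S i) * min 1 (min_ratio * (\<sigma> / Lip (S i)))"
          using L by (auto simp: min_def)
        also have "\<dots> \<le> Lip (S i) * word_ratio S w" using lo[OF i w] L by (intro mult_left_mono) auto
        finally show "min 1 (min_ratio * \<sigma>) \<le> word_ratio S (i # w)" by simp
      qed
      then show ?thesis
        using cut_set.branch[of N W] W by (intro exI[of _ "\<Union>i\<in>{1..N}. (#) i ` W i"]) blast
    qed
  qed
  moreover obtain n where "q ^ n < \<sigma>" using real_arch_pow_inv[OF assms q(2)] by blast
  ultimately show ?thesis using less_imp_le by blast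
qed

lemma cut_set_card_ge:
  assumes W: "cut_set N W" and up: "\<And>w. w \<in> W \<Longrightarrow> word_ratio S w \<le> \<sigma>" and \<sigma>: "0 < \<sigma>"
  shows "\<sigma> powr - s \<le> real (card W)"
proof -
  have "1 = (\<Sum>w\<in>W. word_ratio S w powr s)"
    using cut_set_sum[OF W Lip_bounds(1) sum_Lip] by simp
  also have "\<dots> \<le> (\<Sum>w\<in>W. \<sigma> powr s)"
  proof (intro sum_mono powr_mono2 s_nonneg up)
    fix w assume "w \<in> W"
    then show "0 \<le> word_ratio S w"
      using scales_word[OF cut_set_words[OF W]] by (simp add: scales_by_def less_imp_le)
  qed
  finally show ?thesis using \<sigma> by (simp add: powr_minus field_simps)
qed

lemma cut_set_card_le:
  assumes W: "cut_set N W" and lo: "\<And>w. w \<in> W \<Longrightarrow> \<tau> \<le> word_ratio S w" and \<tau>: "0 < \<tau>"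
  shows "real (card W) \<le> \<tau> powr - s"
proof -
  have "(\<Sum>w\<in>W. \<tau> powr s) \<le> (\<Sum>w\<in>W. word_ratio S w powr s)"
    using lo \<tau> by (intro sum_mono powr_mono2 s_nonneg) auto
  also have "\<dots> = 1" by (rule cut_set_sum[OF W Lip_bounds(1) sum_Lip])
  finally show ?thesis using \<tau> by (simp add: powr_minus field_simps)
qed

section \<open>Covering numbers of self-similar sets\<close>

text \<open>A volume comparison. The sets \<open>S\<^sub>w(K)\<close> for a fixed compact ball \<open>K\<close> in \<open>U\<close> are disjoint and of
  measure at least \<open>\<rho>\<^sup>d \<eta>\<close>. If \<open>S\<^sub>w(C)\<close> meets \<open>A\<close> then \<open>S\<^sub>w(K)\<close> lies in a ball of radius \<open>M \<rho>\<close> about a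
  point of \<open>A\<close>, because \<open>S\<^sub>w\<close> of the whole space has diameter at most \<open>D \<rho> / min_ratio\<close>. The ball has
  measure at most \<open>c (M \<rho>)\<^sup>d\<close>.\<close>

lemma pieces_meeting_bounded:
  assumes X: "ahlfors_regular (UNIV :: 'a set)"
    and U: "U \<noteq> {}" "open U" "\<And>i. i \<in> {1..N} \<Longrightarrow> S i ` U \<subseteq> U"
      "disjoint_family_on (\<lambda>i. S i ` U) {1..N}"
  shows "\<exists>L>0. \<forall>\<rho> W A C. 0 < \<rho> \<longrightarrow> cut_set N W \<longrightarrow>
      (\<forall>w\<in>W. \<rho> \<le> word_ratio S w \<and> word_ratio S w \<le> \<rho> / min_ratio) \<longrightarrow>
      diameter A \<le> \<rho> \<longrightarrow> real (card {w \<in> W. A \<inter> word_map S w ` C \<noteq> {}}) \<le> L"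
proof -
  define D where "D = diameter (UNIV :: 'a set)"
  have bounded: "bounded A" for A :: "'a set"
    using bounded_subset[OF compact_imp_bounded[OF compact_space]] by simp
  have dist_D: "dist x y \<le> D" for x y :: 'a
    unfolding D_def by (rule diameter_bounded_bound) (auto intro: bounded)
  obtain a b :: 'a where "a \<noteq> b" using nontrivial by blast
  then have D: "0 < D" using dist_D[of a b] by (smt (verit) zero_less_dist_iff)
  define d where "d = real_of_ereal (hausdorff_dim (UNIV :: 'a set))"
  have d: "0 \<le> d"
  proof -
    have "0 \<le> hausdorff_dim (UNIV :: 'a set)"
      unfolding hausdorff_dim_def by (rule Inf_greatest) auto
    then show ?thesis by (simp add: d_def real_of_ereal_pos)
  qed
  obtain c where c: "0 < c"
    and lo: "\<And>(x::'a) R. 0 < R \<Longrightarrow> R \<le> D \<Longrightarrow> ennreal (1 / c * R powr d) \<le> hausdorff_measure d (ball x R)"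
    and up': "\<And>(x::'a) R. 0 < R \<Longrightarrow> R \<le> D \<Longrightarrow> hausdorff_measure d (ball x R) \<le> ennreal (c * R powr d)"
    using X unfolding ahlfors_regular_def Let_def D_def d_def by auto
  have one: "1 \<in> {1..N}" using N_pos by simp
  have up: "hausdorff_measure d (ball x R) \<le> ennreal (c * R powr d)" if "0 < R" for x :: 'a and R
    using hausdorff_measure_ball_le[OF scales[OF one] Lip_bounds(2)[OF one] d D _ up' that] c by simp
  obtain u e where u: "0 < e" "ball u e \<subseteq> U" using U(1,2) open_contains_ball by blast
  define b where "b = min (e / 2) D"
  have b: "0 < b" "b \<le> D" "b < e" using u D by (auto simp: b_def)
  define K where "K = cball u b"
  have KU: "K \<subseteq> U" using u b by (force simp: K_def)
  have K: "compact K" using compact_Int_closed[OF compact_space, of K] by (simp add: K_def)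
  define \<eta> where "\<eta> = 1 / c * b powr d"
  have \<eta>: "0 < \<eta>" using b c by (simp add: \<eta>_def)
  have HK: "ennreal \<eta> \<le> hausdorff_measure d K"
  proof -
    have "ennreal \<eta> \<le> hausdorff_measure d (ball u b)" unfolding \<eta>_def by (rule lo[OF b(1,2)])
    also have "\<dots> \<le> hausdorff_measure d K" by (rule hausdorff_measure_mono) (auto simp: K_def)
    finally show ?thesis .
  qed
  \<comment> \<open>\<open>1 + D / min_ratio\<close> bounds the distances in units of \<open>\<rho>\<close>; the additional 1 makes the
    bound strict, as the ball is open.\<close>
  define M where "M = 2 + D / min_ratio"
  have M: "0 < M" using D min_ratio(1) by (simp add: M_def add_pos_pos)
  define L where "L = c * M powr d / \<eta>"
  have L: "0 < L" using c M \<eta> by (simp add: L_def)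
  have "real (card {w \<in> W. A \<inter> word_map S w ` C \<noteq> {}}) \<le> L"
    if \<rho>: "0 < \<rho>" and W: "cut_set N W"
      and ratio: "\<forall>w\<in>W. \<rho> \<le> word_ratio S w \<and> word_ratio S w \<le> \<rho> / min_ratio"
      and A: "diameter A \<le> \<rho>" for \<rho> W A C
  proof -
    define J where "J = {w \<in> W. A \<inter> word_map S w ` C \<noteq> {}}"
    have J: "finite J" "J \<subseteq> W" using cut_set_finite[OF W] by (auto simp: J_def)
    show ?thesis
    proof (cases "J = {}")
      case True
      then show ?thesis using L unfolding J_def[symmetric] by simp
    next
      case False
      then obtain x where x: "x \<in> A" by (auto simp: J_def)
      have sc: "scales_by (word_ratio S w) (word_map S w)" if "w \<in> W" for w
        using scales_word cut_set_words[OF W that] by blast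
      have "(\<Union>w\<in>J. word_map S w ` K) \<subseteq> ball x (M * \<rho>)"
      proof safe
        fix w k assume w: "w \<in> J" and "k \<in> K"
        obtain z where z: "word_map S w z \<in> A" using w by (auto simp: J_def)
        have wW: "w \<in> W" using w J by auto
        have "dist x (word_map S w k)
            \<le> dist x (word_map S w z) + dist (word_map S w z) (word_map S w k)"
          by (rule dist_triangle)
        also have "\<dots> = dist x (word_map S w z) + word_ratio S w * dist z k"
          using sc[OF wW] by (simp add: scales_by_def)
        also have "\<dots> \<le> \<rho> + \<rho> / min_ratio * D"
        proof (intro add_mono mult_mono)
          show "dist x (word_map S w z) \<le> \<rho>"
            using diameter_bounded_bound[OF bounded x z] A by linarith
        qed (use ratio wW dist_D \<rho> min_ratio(1) in auto)
        also have "\<dots> < M * \<rho>" using \<rho> by (simp add: M_def field_simps)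
        finally show "word_map S w k \<in> ball x (M * \<rho>)" by simp
      qed
      then have *: "hausdorff_measure d (\<Union>w\<in>J. word_map S w ` K) \<le> ennreal (c * (M * \<rho>) powr d)"
        using order_trans[OF hausdorff_measure_mono up] M \<rho> by simp
      have "disjoint_family_on (\<lambda>w. word_map S w ` U) W"
        using cut_set_disjoint[OF W U(3,4)] scales_by_inj[OF scales] by blast
      then have disj: "disjoint_family_on (\<lambda>w. word_map S w ` K) J"
        using J(2) KU unfolding disjoint_family_on_def by blast
      have "ennreal (real (card J) * (\<rho> powr d * \<eta>)) = (\<Sum>w\<in>J. ennreal (\<rho> powr d * \<eta>))"
        using \<rho> \<eta> by (simp add: ennreal_mult ennreal_of_nat_eq_real_of_nat)
      also have "\<dots> \<le> (\<Sum>w\<in>J. hausdorff_measure d (word_map S w ` K))"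
      proof (rule sum_mono)
        fix w assume "w \<in> J"
        then have w: "w \<in> W" using J by auto
        have "ennreal (\<rho> powr d * \<eta>) = ennreal (\<rho> powr d) * ennreal \<eta>"
          using \<eta> by (simp add: ennreal_mult)
        also have "\<dots> \<le> ennreal (word_ratio S w powr d) * hausdorff_measure d K"
          using ratio w \<rho> d HK by (intro mult_mono ennreal_leI powr_mono2) auto
        also have "\<dots> \<le> hausdorff_measure d (word_map S w ` K)"
          by (rule hausdorff_measure_image_ge[OF sc[OF w] d])
        finally show "ennreal (\<rho> powr d * \<eta>) \<le> hausdorff_measure d (word_map S w ` K)" .
      qed
      also have "\<dots> \<le> hausdorff_measure d (\<Union>w\<in>J. word_map S w ` K)"
      proof (rule hausdorff_measure_disjoint_compact[OF J(1) _ disj d])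
        fix w assume "w \<in> J"
        then show "compact (word_map S w ` K)"
          using J(2) by (intro compact_continuous_image[OF scales_by_continuous[OF sc] K]) auto
      qed
      also note *
      finally have "real (card J) * (\<rho> powr d * \<eta>) \<le> c * (M * \<rho>) powr d"
        using c by (subst (asm) ennreal_le_iff) auto
      then have "\<rho> powr d * (real (card J) * \<eta>) \<le> \<rho> powr d * (c * M powr d)"
        using M \<rho> by (simp add: powr_mult mult_ac)
      then have "real (card J) * \<eta> \<le> c * M powr d" using \<rho> by simp
      then show ?thesis using \<eta> unfolding L_def J_def by (simp add: field_simps)
    qed
  qed
  then show ?thesis using L by blast
qed

text \<open>A cover of \<open>f ` E\<close> pulls back to a cover of \<open>E\<close> with diameters at most \<open>\<delta> / r\<close>. Counting only the
  sets that meet the image prepares the double counting over all copies.\<close>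

lemma covering_number_image_ge:
  assumes f: "scales_by r f" and \<U>: "finite \<U>" "f ` E \<subseteq> \<Union>\<U>"
    "\<And>A. A \<in> \<U> \<Longrightarrow> bounded A \<and> diameter A \<le> \<delta>" and le: "\<delta> / r \<le> \<epsilon>"
  shows "covering_number \<epsilon> E \<le> card {A \<in> \<U>. A \<inter> f ` E \<noteq> {}}"
proof -
  let ?V = "{A \<in> \<U>. A \<inter> f ` E \<noteq> {}}"
  have r: "0 < r" using f by (simp add: scales_by_def)
  have "covering_number \<epsilon> E \<le> card ((\<lambda>A. f -` A) ` ?V)"
  proof (rule covering_number_le_card)
    show "E \<subseteq> \<Union>((\<lambda>A. f -` A) ` ?V)" using \<U>(2) by blast
    fix B assume "B \<in> (\<lambda>A. f -` A) ` ?V"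
    then obtain A where A: "A \<in> \<U>" "B = f -` A" by blast
    have "diameter (f -` A) \<le> diameter A / r"
      using \<U>(3)[OF A(1)] by (intro scales_by_vimage_diameter[OF f]) auto
    also have "\<dots> \<le> \<delta> / r" using \<U>(3)[OF A(1)] r by (intro divide_right_mono) auto
    finally show "bounded B \<and> diameter B \<le> \<epsilon>"
      using \<U>(3)[OF A(1)] scales_by_vimage_diameter(1)[OF f, of A] A(2) le by auto
  qed (use \<U>(1) in auto)
  also have "\<dots> \<le> card ?V" using \<U>(1) by (intro card_image_le) auto
  finally show ?thesis .
qed

text \<open>Count the pairs of a word \<open>w\<close> in the cut set at scale \<open>\<rho>\<close> and a set in an optimal cover of \<open>F\<close> that
  meets \<open>S\<^sub>w(C)\<close>. Each word occurs in at least \<open>N(\<delta>/\<rho>, C)\<close> pairs, each covering set in at most \<open>L\<close>.\<close>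

lemma covering_number_ge:
  assumes X: "ahlfors_regular (UNIV :: 'a set)"
    and U: "U \<noteq> {}" "open U" "\<And>i. i \<in> {1..N} \<Longrightarrow> S i ` U \<subseteq> U"
      "disjoint_family_on (\<lambda>i. S i ` U) {1..N}"
    and F: "C \<subseteq> F" "\<And>i. i \<in> {1..N} \<Longrightarrow> S i ` F \<subseteq> F"
  shows "\<exists>c>0. \<forall>\<delta> \<rho>. 0 < \<delta> \<longrightarrow> \<delta> \<le> \<rho> \<longrightarrow> \<rho> \<le> 1 \<longrightarrow>
      c * \<rho> powr - s * real (covering_number (\<delta> / \<rho>) C) \<le> real (covering_number \<delta> F)"
proof -
  obtain L where L: "0 < L" and meet: "\<And>\<rho> W A C. 0 < \<rho> \<Longrightarrow> cut_set N W \<Longrightarrow>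
      \<forall>w\<in>W. \<rho> \<le> word_ratio S w \<and> word_ratio S w \<le> \<rho> / min_ratio \<Longrightarrow>
      diameter A \<le> \<rho> \<Longrightarrow> real (card {w \<in> W. A \<inter> word_map S w ` C \<noteq> {}}) \<le> L"
    using pieces_meeting_bounded[OF X U] by blast
  define c where "c = min_ratio powr s / L"
  have "c * \<rho> powr - s * real (covering_number (\<delta> / \<rho>) C) \<le> real (covering_number \<delta> F)"
    if \<delta>: "0 < \<delta>" "\<delta> \<le> \<rho>" "\<rho> \<le> 1" for \<delta> \<rho>
  proof -
    have \<rho>: "0 < \<rho>" using \<delta> by simp
    \<comment> \<open>Ratios must be at least \<open>\<rho>\<close> for the copies not to be too small, so the cut is made at
      \<open>\<rho> / min_ratio\<close>.\<close>
    have m: "min_ratio * (\<rho> / min_ratio) = \<rho>" using min_ratio(1) by simp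
    obtain W where W: "cut_set N W"
      and ratio: "\<forall>w\<in>W. \<rho> \<le> word_ratio S w \<and> word_ratio S w \<le> \<rho> / min_ratio"
      using cut_set_exists[of "\<rho> / min_ratio"] \<rho> min_ratio(1) \<delta>(3) unfolding m by auto
    note finW = cut_set_finite[OF W]
    obtain \<U> where \<U>: "finite \<U>" "card \<U> = covering_number \<delta> F" "F \<subseteq> \<Union>\<U>"
      "\<And>A. A \<in> \<U> \<Longrightarrow> bounded A \<and> diameter A \<le> \<delta>"
      using covering_number_attained[OF compact_space \<delta>(1), of F] by blast
    have cov: "covering_number (\<delta> / \<rho>) C \<le> card {A \<in> \<U>. A \<inter> word_map S w ` C \<noteq> {}}"
      if w: "w \<in> W" for w
    proof (rule covering_number_image_ge[OF _ \<U>(1) _ \<U>(4)])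
      have set: "set w \<subseteq> {1..N}" by (rule cut_set_words[OF W w])
      then show "scales_by (word_ratio S w) (word_map S w)" by (rule scales_word)
      have "word_map S w ` C \<subseteq> word_map S w ` F" using F(1) by blast
      also have "\<dots> \<subseteq> F" by (rule word_map_invariant[OF F(2) set])
      finally show "word_map S w ` C \<subseteq> \<Union>\<U>" using \<U>(3) by blast
      show "\<delta> / word_ratio S w \<le> \<delta> / \<rho>"
        using ratio w \<rho> \<delta>(1) by (intro divide_left_mono) (auto intro: mult_pos_pos less_le_trans)
    qed
    have "\<rho> powr - s * min_ratio powr s * real (covering_number (\<delta> / \<rho>) C)
        \<le> real (card W) * real (covering_number (\<delta> / \<rho>) C)"
    proof (rule mult_right_mono)
      have "\<rho> powr - s * min_ratio powr s = (\<rho> / min_ratio) powr - s"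
        using \<rho> min_ratio(1) by (simp add: powr_divide powr_minus field_simps)
      also have "\<dots> \<le> real (card W)"
        using ratio \<rho> min_ratio(1) by (intro cut_set_card_ge[OF W]) auto
      finally show "\<rho> powr - s * min_ratio powr s \<le> real (card W)" .
    qed simp
    also have "\<dots> = (\<Sum>w\<in>W. real (covering_number (\<delta> / \<rho>) C))" by simp
    also have "\<dots> \<le> (\<Sum>w\<in>W. real (card {A \<in> \<U>. A \<inter> word_map S w ` C \<noteq> {}}))"
      using cov by (intro sum_mono) simp
    also have "\<dots> = (\<Sum>A\<in>\<U>. real (card {w \<in> W. A \<inter> word_map S w ` C \<noteq> {}}))"
      using sum.swap_restrict[OF finW \<U>(1), of "\<lambda>_ _. 1 :: real"
          "\<lambda>w A. A \<inter> word_map S w ` C \<noteq> {}"] by simp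
    also have "\<dots> \<le> (\<Sum>A\<in>\<U>. L)"
      using \<U>(4) \<delta>(2) by (intro sum_mono meet[OF \<rho> W ratio]) force
    also have "\<dots> = L * real (covering_number \<delta> F)" using \<U>(2) by simp
    finally show ?thesis using L by (simp add: c_def field_simps)
  qed
  moreover have "0 < c" using L min_ratio(1) by (simp add: c_def)
  ultimately show ?thesis by blast
qed

text \<open>A cut set at scale proportional to \<open>\<delta>\<close> covers \<open>E\<close> by images of diameter at most \<open>\<delta>\<close>.\<close>

lemma covering_number_le:
  assumes E: "E \<subseteq> (\<Union>i\<in>{1..N}. S i ` E)"
  shows "\<exists>c>0. \<forall>\<delta>. 0 < \<delta> \<longrightarrow> \<delta> \<le> 1 \<longrightarrow> real (covering_number \<delta> E) \<le> c * \<delta> powr - s"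
proof -
  have bE: "bounded E"
    using bounded_subset[OF compact_imp_bounded[OF compact_space]] by simp
  \<comment> \<open>Adding 1 keeps \<open>D\<close> positive when \<open>E\<close> is a single point.\<close>
  define D where "D = diameter E + 1"
  have D: "1 \<le> D" using diameter_ge_0[OF bE] by (simp add: D_def)
  define c where "c = (min_ratio / D) powr - s"
  have "real (covering_number \<delta> E) \<le> c * \<delta> powr - s" if \<delta>: "0 < \<delta>" "\<delta> \<le> 1" for \<delta>
  proof -
    have \<sigma>: "0 < \<delta> / D" "\<delta> / D \<le> 1" using \<delta> D by (auto simp: field_simps)
    have "min_ratio * (\<delta> / D) \<le> 1" using \<sigma> min_ratio(1,2) by (intro mult_le_one) auto
    then obtain W where W: "cut_set N W"
      and ratio: "\<And>w. w \<in> W \<Longrightarrow> min_ratio * (\<delta> / D) \<le> word_ratio S w"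
        "\<And>w. w \<in> W \<Longrightarrow> word_ratio S w \<le> \<delta> / D"
      using cut_set_exists[OF \<sigma>(1)] by auto
    have "covering_number \<delta> E \<le> card ((\<lambda>w. word_map S w ` E) ` W)"
    proof (rule covering_number_le_card)
      show "E \<subseteq> \<Union>((\<lambda>w. word_map S w ` E) ` W)" by (rule cut_set_covers[OF W E])
      fix A assume "A \<in> (\<lambda>w. word_map S w ` E) ` W"
      then obtain w where w: "w \<in> W" "A = word_map S w ` E" by blast
      have sc: "scales_by (word_ratio S w) (word_map S w)"
        by (rule scales_word[OF cut_set_words[OF W w(1)]])
      have "diameter A \<le> word_ratio S w * diameter E"
        unfolding w(2) by (rule scales_by_image_diameter[OF sc bE])
      also have "\<dots> \<le> \<delta> / D * D"
        using ratio(2)[OF w(1)] \<sigma> diameter_ge_0[OF bE] by (intro mult_mono) (auto simp: D_def)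
      also have "\<dots> = \<delta>" using D by simp
      finally show "bounded A \<and> diameter A \<le> \<delta>"
        unfolding w(2) using scales_by_image_diameter(1)[OF sc bE] by simp
    qed (use cut_set_finite[OF W] in auto)
    also have "\<dots> \<le> card W" by (rule card_image_le[OF cut_set_finite[OF W]])
    finally have "real (covering_number \<delta> E) \<le> real (card W)" by simp
    also have "\<dots> \<le> (min_ratio * (\<delta> / D)) powr - s"
      by (rule cut_set_card_le[OF W ratio(1) mult_pos_pos[OF min_ratio(1) \<sigma>(1)]])
    also have "\<dots> = (min_ratio / D * \<delta>) powr - s" by simp
    also have "\<dots> = c * \<delta> powr - s"
      unfolding c_def using min_ratio(1) D \<delta> by (subst powr_mult) auto
    finally show ?thesis .
  qed
  moreover have "0 < c" using min_ratio(1) D by (simp add: c_def)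
  ultimately show ?thesis by blast
qed

end

section \<open>From covering numbers to lower box dimensions\<close>

lemma tendsto_const_div_ln: "((\<lambda>\<delta>::real. k / - ln \<delta>) \<longlongrightarrow> 0) (at_right 0)"
proof (intro tendsto_divide_0[OF tendsto_const] filterlim_at_top_imp_at_infinity)
  show "LIM \<delta> at_right (0::real). - ln \<delta> :> at_top"
    using ln_at_0 by (simp add: filterlim_uminus_at_bot)
qed

lemma eventually_at_right_0_less_1: "eventually (\<lambda>\<delta>::real. 0 < \<delta> \<and> \<delta> < 1) (at_right 0)"
  using eventually_at_right_real[of 0 1] by simp

text \<open>Taking logarithms, \<open>ln N / - ln \<delta> \<ge> ln c / - ln \<delta> + b + a q(\<delta>)\<close>, and the first summand tends to 0.
  As \<open>a \<ge> 0\<close>, the lower limit of the right-hand side is at least \<open>b + a P\<close>.\<close>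

lemma lower_box_dim_ge:
  assumes c: "0 < c" and a: "0 \<le> a"
    and cov: "\<And>\<delta>. 0 < \<delta> \<Longrightarrow> \<delta> < 1 \<Longrightarrow> c * \<delta> powr - (b + a * q \<delta>) \<le> real (covering_number \<delta> E)"
    and P: "ereal P \<le> Liminf (at_right 0) (\<lambda>\<delta>. ereal (q \<delta>))"
  shows "ereal (b + a * P) \<le> lower_box_dim E"
  unfolding lower_box_dim_def le_Liminf_iff
proof (intro allI impI)
  fix y assume y: "y < ereal (b + a * P)"
  obtain z where z: "y < ereal z" "z < b + a * P"
    using ereal_dense2[OF y] by auto
  \<comment> \<open>Chosen so that an error \<open>\<epsilon>\<close> in both \<open>q\<close> and \<open>ln c / - ln \<delta>\<close> still leaves the value \<open>z\<close>.\<close>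
  define \<epsilon> where "\<epsilon> = (b + a * P - z) / (a + 1)"
  have \<epsilon>: "0 < \<epsilon>" using z a by (simp add: \<epsilon>_def)
  have "ereal (P - \<epsilon>) < Liminf (at_right 0) (\<lambda>\<delta>. ereal (q \<delta>))"
    using \<epsilon> by (intro less_le_trans[OF _ P]) simp
  then have 1: "eventually (\<lambda>\<delta>. P - \<epsilon> < q \<delta>) (at_right 0)"
    by (auto dest: less_LiminfD)
  have 2: "eventually (\<lambda>\<delta>. - \<epsilon> < ln c / - ln \<delta>) (at_right 0)"
    using \<epsilon> by (intro order_tendstoD(1)[OF tendsto_const_div_ln]) simp
  show "eventually (\<lambda>\<delta>. y < ereal (ln (real (covering_number \<delta> E)) / - ln \<delta>)) (at_right 0)"
    using 1 2 eventually_at_right_0_less_1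
  proof eventually_elim
    case (elim \<delta>)
    then have \<delta>: "0 < \<delta>" "\<delta> < 1" and l: "0 < - ln \<delta>" by auto
    have "ln c + (b + a * q \<delta>) * - ln \<delta> = ln (c * \<delta> powr - (b + a * q \<delta>))"
      using c \<delta> by (simp add: ln_mult ln_powr algebra_simps)
    also have "\<dots> \<le> ln (real (covering_number \<delta> E))"
      using cov[OF \<delta>] c \<delta> by (intro ln_mono) auto
    finally have "(ln c + (b + a * q \<delta>) * - ln \<delta>) / - ln \<delta> \<le> ln (real (covering_number \<delta> E)) / - ln \<delta>"
      using l by (intro divide_right_mono) auto
    moreover have "(ln c + (b + a * q \<delta>) * - ln \<delta>) / - ln \<delta> = ln c / - ln \<delta> + (b + a * q \<delta>)"
      using l by (subst add_divide_distrib) simp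
    moreover have "a * (P - \<epsilon>) \<le> a * q \<delta>" using elim(1) a by (intro mult_left_mono) auto
    moreover have "z = b + a * P - \<epsilon> * (a + 1)" using a by (simp add: \<epsilon>_def)
    then have "z = - \<epsilon> + (b + a * (P - \<epsilon>))" by (simp add: algebra_simps)
    ultimately have "z \<le> ln (real (covering_number \<delta> E)) / - ln \<delta>"
      using elim(2) by linarith
    then show ?case using z(1) less_le_trans by fastforce
  qed
qed

lemma lower_box_dim_le:
  fixes E :: "'a::metric_space set"
  assumes X: "compact (UNIV :: 'a set)" "E \<noteq> {}" and c: "0 < c"
    and cov: "\<And>\<delta>. 0 < \<delta> \<Longrightarrow> \<delta> \<le> 1 \<Longrightarrow> real (covering_number \<delta> E) \<le> c * \<delta> powr - s"
  shows "lower_box_dim E \<le> ereal s"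
proof -
  have "lower_box_dim E \<le> Liminf (at_right 0) (\<lambda>\<delta>. ereal (ln c / - ln \<delta> + s))"
    unfolding lower_box_dim_def
  proof (rule Liminf_mono, rule eventually_mono[OF eventually_at_right_0_less_1])
    fix \<delta> :: real assume \<delta>: "0 < \<delta> \<and> \<delta> < 1"
    then have l: "0 < - ln \<delta>" by simp
    have "ln (real (covering_number \<delta> E)) \<le> ln (c * \<delta> powr - s)"
      using cov[of \<delta>] \<delta> covering_number_pos[OF X(1) _ X(2), of \<delta>] by (intro ln_mono) auto
    also have "\<dots> = ln c + s * - ln \<delta>" using c \<delta> by (simp add: ln_mult ln_powr)
    finally have "ln (real (covering_number \<delta> E)) / - ln \<delta> \<le> (ln c + s * - ln \<delta>) / - ln \<delta>"
      using l by (intro divide_right_mono) auto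
    also have "\<dots> = ln c / - ln \<delta> + s" using l by (subst add_divide_distrib) simp
    finally show "ereal (ln (real (covering_number \<delta> E)) / - ln \<delta>) \<le> ereal (ln c / - ln \<delta> + s)"
      by simp
  qed
  also have "\<dots> = ereal s"
  proof (rule lim_imp_Liminf)
    have "((\<lambda>\<delta>. ln c / - ln \<delta> + s) \<longlongrightarrow> 0 + s) (at_right 0)"
      by (intro tendsto_add tendsto_const tendsto_const_div_ln)
    then show "((\<lambda>\<delta>. ereal (ln c / - ln \<delta> + s)) \<longlongrightarrow> ereal s) (at_right 0)" by simp
  qed simp
  finally show ?thesis .
qed

lemma lower_box_dim_nonneg:
  fixes E :: "'a::metric_space set"
  assumes "compact (UNIV :: 'a set)" "E \<noteq> {}"
  shows "0 \<le> lower_box_dim E"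
  unfolding lower_box_dim_def
proof (rule Liminf_bounded, rule eventually_mono[OF eventually_at_right_0_less_1])
  fix \<delta> :: real assume \<delta>: "0 < \<delta> \<and> \<delta> < 1"
  then have "1 \<le> covering_number \<delta> E" using covering_number_pos[OF assms(1) _ assms(2)] by blast
  then have "0 \<le> ln (real (covering_number \<delta> E)) / - ln \<delta>"
    using \<delta> by (intro divide_nonneg_nonneg) auto
  then show "0 \<le> ereal (ln (real (covering_number \<delta> E)) / - ln \<delta>)" by simp
qed

lemma upper_box_dim_singleton_space:
  fixes E :: "'a::metric_space set"
  assumes one: "\<And>a b :: 'a. a = b"
  shows "upper_box_dim E \<le> 0"
proof -
  have "upper_box_dim E \<le> Limsup (at_right 0) (\<lambda>_::real. 0)"
    unfolding upper_box_dim_def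
  proof (rule Limsup_mono, rule eventually_mono[OF eventually_at_right_0_less_1])
    fix \<delta> :: real assume \<delta>: "0 < \<delta> \<and> \<delta> < 1"
    have "diameter A = 0" for A :: "'a set"
    proof (rule antisym)
      show b: "0 \<le> diameter A"
        by (rule diameter_ge_0) (auto simp: bounded_two_points one intro!: exI[of _ 0])
      show "diameter A \<le> 0" by (rule diameter_leI) (auto simp: one)
    qed
    moreover have "bounded A" for A :: "'a set"
      using one by (auto simp: bounded_two_points intro!: exI[of _ 0])
    ultimately have "covering_number \<delta> E \<le> card {UNIV :: 'a set}"
      using \<delta> by (intro covering_number_le_card) auto
    then have "covering_number \<delta> E = 0 \<or> covering_number \<delta> E = 1" by auto
    then show "ereal (ln (real (covering_number \<delta> E)) / - ln \<delta>) \<le> 0" by auto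
  qed
  also have "\<dots> = 0" by (rule Limsup_const) simp
  finally show ?thesis .
qed

section \<open>Covering exponents\<close>

text \<open>The supremum defining the covering exponent is over a non-empty set: for \<open>p = 0\<close> the condition says
  that at least one set of diameter 1 is needed.\<close>

lemma covering_exponent_set_0:
  fixes C :: "'a::metric_space set"
  assumes "compact (UNIV :: 'a set)" "C \<noteq> {}" "0 < \<delta>"
  shows "(0::real) \<in> {p \<in> {0..1}. real (covering_number (\<delta> powr p) C) \<ge> \<delta> powr (- p * t)}"
  using covering_number_pos[OF assms(1) zero_less_one assms(2)] assms(3) by simp

lemma covering_exponent_at_bounds:
  fixes C :: "'a::metric_space set"
  assumes "compact (UNIV :: 'a set)" "C \<noteq> {}" "0 < \<delta>"
  shows "0 \<le> covering_exponent_at t \<delta> C" "covering_exponent_at t \<delta> C \<le> 1"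
proof -
  note z = covering_exponent_set_0[OF assms, of t]
  show "0 \<le> covering_exponent_at t \<delta> C"
    unfolding covering_exponent_at_def by (rule cSup_upper[OF z]) (auto intro!: bdd_aboveI[of _ 1])
  show "covering_exponent_at t \<delta> C \<le> 1"
    unfolding covering_exponent_at_def
  proof (rule cSup_least)
    show "{p \<in> {0..1}. real (covering_number (\<delta> powr p) C) \<ge> \<delta> powr (- p * t)} \<noteq> {}"
      using z by blast
  qed auto
qed

lemma covering_exponent_bounds:
  fixes C :: "'a::metric_space set"
  assumes "compact (UNIV :: 'a set)" "C \<noteq> {}"
  shows "0 \<le> covering_exponent t C" "covering_exponent t C \<le> 1"
proof -
  note b = covering_exponent_at_bounds[OF assms]
  show "0 \<le> covering_exponent t C"
    unfolding covering_exponent_def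
    by (rule Liminf_bounded, rule eventually_mono[OF eventually_at_right_0_less_1]) (use b in auto)
  have "covering_exponent t C \<le> Liminf (at_right 0) (\<lambda>_::real. 1)"
    unfolding covering_exponent_def
    by (rule Liminf_mono, rule eventually_mono[OF eventually_at_right_0_less_1])
      (use b in \<open>auto simp: one_ereal_def\<close>)
  then show "covering_exponent t C \<le> 1" by (simp add: Liminf_const)
qed

section \<open>The lower box dimension of the inhomogeneous attractor\<close>

context similarity_system
begin

text \<open>For an admissible \<open>p\<close> take \<open>\<rho> = \<delta>\<^sup>1\<^sup>-\<^sup>p\<close>, so that \<open>\<delta>/\<rho> = \<delta>\<^sup>p\<close>. The resulting condition on \<open>p\<close> is closed
  and therefore passes to the supremum, which itself need not be admissible.\<close>

lemma covering_number_exponent_ge: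
  fixes C F :: "'a set"
  assumes C: "C \<noteq> {}" and c: "0 < c"
    and cov: "\<And>\<delta> \<rho>. 0 < \<delta> \<Longrightarrow> \<delta> \<le> \<rho> \<Longrightarrow> \<rho> \<le> 1 \<Longrightarrow>
      c * \<rho> powr - s * real (covering_number (\<delta> / \<rho>) C) \<le> real (covering_number \<delta> F)"
    and t: "s \<le> t" and \<delta>: "0 < \<delta>" "\<delta> < 1"
  shows "c * \<delta> powr - (s + (t - s) * covering_exponent_at t \<delta> C) \<le> real (covering_number \<delta> F)"
proof -
  let ?P = "{p \<in> {0..1}. real (covering_number (\<delta> powr p) C) \<ge> \<delta> powr (- p * t)}"
  let ?N = "real (covering_number \<delta> F)"
  note z = covering_exponent_set_0[OF compact_space C \<delta>(1), of t]
  have P: "c * \<delta> powr - (s + (t - s) * p) \<le> ?N" if p: "p \<in> ?P" for p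
  proof -
    have "c * \<delta> powr - (s + (t - s) * p) = c * (\<delta> powr (1 - p)) powr - s * \<delta> powr (- p * t)"
      using \<delta> by (simp add: powr_powr powr_add[symmetric] algebra_simps)
    also have "\<dots> \<le> c * (\<delta> powr (1 - p)) powr - s * real (covering_number (\<delta> / \<delta> powr (1 - p)) C)"
    proof (rule mult_left_mono)
      have "\<delta> / \<delta> powr (1 - p) = \<delta> powr p" using \<delta> by (simp add: powr_diff)
      then show "\<delta> powr (- p * t) \<le> real (covering_number (\<delta> / \<delta> powr (1 - p)) C)"
        using p by simp
    qed (use c in simp)
    also have "\<dots> \<le> ?N"
    proof (rule cov)
      show "\<delta> \<le> \<delta> powr (1 - p)" using powr_mono'[of "1 - p" 1 \<delta>] p \<delta> by simp
      show "\<delta> powr (1 - p) \<le> 1" using powr_mono'[of 0 "1 - p" \<delta>] p \<delta> by simp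
    qed (use \<delta> in simp)
    finally show ?thesis .
  qed
  have cl: "closed {p. c * \<delta> powr - (s + (t - s) * p) \<le> ?N}"
    using \<delta> by (intro closed_Collect_le continuous_intros) auto
  have "Sup ?P \<in> closure ?P"
  proof (rule closure_contains_Sup)
    show "?P \<noteq> {}" using z by blast
  qed (auto intro!: bdd_aboveI[of _ 1])
  also have "closure ?P \<subseteq> {p. c * \<delta> powr - (s + (t - s) * p) \<le> ?N}"
    using P by (intro closure_minimal cl) auto
  finally show ?thesis by (simp add: covering_exponent_at_def)
qed

text \<open>If \<open>t \<ge> s\<close> the estimate at the exponent \<open>covering_exponent_at t \<delta> C\<close> passes to the lower limit. If
  \<open>t < s\<close> the coefficient \<open>t - s\<close> is negative and a lower limit of exponents gives no such bound;
  instead \<open>\<rho> = \<delta>\<close> shows that the dimension is at least \<open>s \<ge> s + (t - s) P\<close>.\<close>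

lemma lower_box_dim_ge_covering_exponent:
  assumes X: "ahlfors_regular (UNIV :: 'a set)"
    and U: "U \<noteq> {}" "open U" "\<And>i. i \<in> {1..N} \<Longrightarrow> S i ` U \<subseteq> U"
      "disjoint_family_on (\<lambda>i. S i ` U) {1..N}"
    and F: "C \<subseteq> F" "\<And>i. i \<in> {1..N} \<Longrightarrow> S i ` F \<subseteq> F" and C: "C \<noteq> {}"
    and P: "covering_exponent t C = ereal P"
  shows "ereal (s + (t - s) * P) \<le> lower_box_dim F"
proof -
  obtain c where c: "0 < c" and cov: "\<And>\<delta> \<rho>. 0 < \<delta> \<Longrightarrow> \<delta> \<le> \<rho> \<Longrightarrow> \<rho> \<le> 1 \<Longrightarrow>
      c * \<rho> powr - s * real (covering_number (\<delta> / \<rho>) C) \<le> real (covering_number \<delta> F)"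
    using covering_number_ge[OF X U F] by blast
  show ?thesis
  proof (cases "s \<le> t")
    case True
    show ?thesis
    proof (rule lower_box_dim_ge[OF c])
      show "ereal P \<le> Liminf (at_right 0) (\<lambda>\<delta>. ereal (covering_exponent_at t \<delta> C))"
        using P by (simp add: covering_exponent_def)
    qed (use True covering_number_exponent_ge[OF C c cov True] in auto)
  next
    case False
    have "0 \<le> P" using covering_exponent_bounds(1)[OF compact_space C, of t] P by simp
    then have "s + (t - s) * P \<le> s" using False by (simp add: mult_nonpos_nonneg)
    also have "ereal s = ereal (s + 0 * 0)" by simp
    also have "\<dots> \<le> lower_box_dim F"
    proof (rule lower_box_dim_ge[OF c, where q = "\<lambda>_. 0"])
      fix \<delta> :: real assume \<delta>: "0 < \<delta>" "\<delta> < 1"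
      have "c * \<delta> powr - s * 1 \<le> c * \<delta> powr - s * real (covering_number (\<delta> / \<delta>) C)"
        using covering_number_pos[OF compact_space zero_less_one C] c \<delta>
        by (intro mult_left_mono) auto
      also have "\<dots> \<le> real (covering_number \<delta> F)" using \<delta> by (intro cov) auto
      finally show "c * \<delta> powr - (s + 0 * 0) \<le> real (covering_number \<delta> F)" by simp
    qed (auto simp: Liminf_const)
    finally show ?thesis by simp
  qed
qed

end

theorem theorem2p7:
  fixes S :: "nat \<Rightarrow> 'a::metric_space \<Rightarrow> 'a" and N :: nat and C :: "'a set" and s :: real
  assumes "compact (UNIV :: 'a set)"
    and "ahlfors_regular (UNIV :: 'a set)"
    and "similarity_ifs N S"
    and "s = similarity_dim N S"
    and "C \<noteq> {}" and "compact C"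
    and "condensation_open_set_condition N S C"
    and "max (ereal s) (lower_box_dim C) < upper_box_dim C"
  shows "(\<forall>t::real. 0 \<le> t \<longrightarrow>
            lower_box_dim (inhomogeneous_attractor N S C)
              \<ge> covering_exponent t C * ereal t + (1 - covering_exponent t C) * ereal s)
       \<and> ((\<exists>t::real. ereal t > max (ereal s) (lower_box_dim C) \<and>
              covering_exponent t C > max 0 ((lower_box_dim C - ereal s) / ereal (t - s)))
          \<longrightarrow> lower_box_dim (inhomogeneous_attractor N S C)
                > max (lower_box_dim (homogeneous_attractor N S)) (lower_box_dim C))"
proof -
  note lC = lower_box_dim_nonneg[OF assms(1,5)]
  \<comment> \<open>A one-point space is excluded by the gap below the upper box dimension of \<open>C\<close>.\<close>
  have nontrivial: "\<exists>a b :: 'a. a \<noteq> b"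
  proof (rule ccontr)
    assume "\<not> ?thesis"
    then have "upper_box_dim C \<le> 0" by (intro upper_box_dim_singleton_space) blast
    also note lC
    finally show False using assms(8) by (simp add: max_def split: if_splits)
  qed
  interpret similarity_system S N
    using assms(1,3) nontrivial by unfold_locales
  let ?F = "inhomogeneous_attractor N S C" and ?E = "homogeneous_attractor N S"
  obtain U where U0: "U \<noteq> {}" "open U" "(\<Union>i\<in>{1..N}. S i ` U) \<subseteq> U"
      "disjoint_family_on (\<lambda>i. S i ` U) {1..N}"
    using assms(7) unfolding condensation_open_set_condition_def by metis
  have U: "U \<noteq> {}" "open U" "\<And>i. i \<in> {1..N} \<Longrightarrow> S i ` U \<subseteq> U"
      "disjoint_family_on (\<lambda>i. S i ` U) {1..N}"
    using U0 by (blast, blast, blast, blast)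
  have "?F = (\<Union>i\<in>{1..N}. S i ` ?F) \<union> C"
    using theI'[OF inhomogeneous_attractor_ex1[OF assms(1,3,6)]]
    unfolding inhomogeneous_attractor_def[symmetric] by simp
  then have F: "C \<subseteq> ?F" "\<And>i. i \<in> {1..N} \<Longrightarrow> S i ` ?F \<subseteq> ?F" by blast+
  have E: "?E \<noteq> {}" "?E \<subseteq> (\<Union>i\<in>{1..N}. S i ` ?E)"
    using theI'[OF homogeneous_attractor_ex1[OF assms(1,3)]]
    unfolding homogeneous_attractor_def[symmetric] by auto
  have dimE: "lower_box_dim ?E \<le> ereal s"
    using covering_number_le[OF E(2)] lower_box_dim_le[OF assms(1) E(1)] assms(4) by blast
  have "\<exists>P. covering_exponent t C = ereal P" for t
    using covering_exponent_bounds[OF assms(1,5), of t]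
    by (cases "covering_exponent t C") auto
  then obtain p where p: "\<And>t. covering_exponent t C = ereal (p t)" by metis
  have main: "ereal (s + (t - s) * p t) \<le> lower_box_dim ?F" for t
    using lower_box_dim_ge_covering_exponent[OF assms(2) U F assms(5) p] assms(4) by simp
  show ?thesis
  proof (intro conjI allI impI)
    fix t :: real
    have "covering_exponent t C * ereal t + (1 - covering_exponent t C) * ereal s
        = ereal (s + (t - s) * p t)"
      by (simp add: p one_ereal_def algebra_simps)
    then show "covering_exponent t C * ereal t + (1 - covering_exponent t C) * ereal s
        \<le> lower_box_dim ?F"
      using main by simp
  next
    assume "\<exists>t::real. ereal t > max (ereal s) (lower_box_dim C) \<and>
        covering_exponent t C > max 0 ((lower_box_dim C - ereal s) / ereal (t - s))"
    then obtain t :: real where t: "ereal s < ereal t" "lower_box_dim C < ereal t"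
      and pt: "0 < covering_exponent t C"
        "(lower_box_dim C - ereal s) / ereal (t - s) < covering_exponent t C"
      by auto
    obtain l where l: "lower_box_dim C = ereal l"
      using lC t(2) by (cases "lower_box_dim C") auto
    have ts: "0 < t - s" using t(1) by simp
    have "0 < p t" "(l - s) / (t - s) < p t" using pt ts by (simp_all add: p l)
    then have "s < s + (t - s) * p t" "l < s + (t - s) * p t"
      using ts by (simp_all add: field_simps)
    then have "max (ereal s) (lower_box_dim C) < ereal (s + (t - s) * p t)" by (simp add: l)
    then show "max (lower_box_dim ?E) (lower_box_dim C) < lower_box_dim ?F"
      using main[of t] max.mono[OF dimE order_refl[of "lower_box_dim C"]]
      by (meson le_less_trans less_le_trans)
  qed
qed

end
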